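(* Let $0<\alpha<1$, let $U\subseteq\mathbb{C}$ be open, let $x_0\in\overline{U}$, let $0<\lambda<1$ and let $t$ be a non-negative integer. If $$\sum_{n=1}^{\infty}2^{(t+\lambda+1)n}\,M_*^{1+\alpha}(A_n\setminus U)=\infty,$$ then for every representing measure $\mu$ for $x_0$ on $A_\alpha(U)$, $$\mu^{t+\lambda}(x_0)=\int\frac{d|\mu|(\zeta)}{|\zeta-x_0|^{t+\lambda}}=\infty,$$ i.e. $x_0$ is a $(t+\lambda)$-spike for $A_\alpha(U)$.
   Context: For $0<\alpha<1$, $\mathrm{Lip}\alpha(\mathbb{C})$ is the space of functions $f:\mathbb{C}\to\mathbb{C}$ for which there is $k>0$ with $|f(z)-f(w)|\le k|z-w|^\alpha$ for all $z,w$; its norm is $\|f\|_{\mathrm{Lip}\alpha(\mathbb{C})}=\sup|f|+k(f)$, where $k(f)$ is the smallest such $k$. The little Lipschitz class $\mathrm{lip}\alpha(\mathbb{C})$ consists of those $f\in\mathrm{Lip}\alpha(\mathbb{C})$ such that for each $\epsilon>0$ there is $\delta>0$ with $|f(z)-f(w)|\le\epsilon|z-w|^\alpha$ whenever $|z-w|<\delta$. $A_\alpha(U)$ denotes the space of functions in $\mathrm{lip}\alpha(\mathbb{C})$ that are analytic on $U$. $A_n=\{z: 2^{-n-1}<|z-x_0|<2^{-n}\}$. A measure function is a nondecreasing $h:[0,\infty)\to[0,\infty)$; $M_h(E)=\inf\sum h(\operatorname{diam}B)$, the infimum over all countable covers of $E$ by balls $B$. The lower $(1+\alpha)$-dimensional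 Hausdorff content is $M_*^{1+\alpha}(E)=\sup M_h(E)$, the supremum over measure functions $h$ with $h(r)\le r^{1+\alpha}$ and $r^{-1-\alpha}h(r)\to0$ as $r\to0$. A (finite complex Borel) measure $\mu$ is a representing measure for $x_0$ on $A_\alpha(U)$ if $\int f\,d\mu=f(x_0)$ for all $f\in A_\alpha(U)$. For $\tau>0$, $\mu^\tau(z)=\int\frac{d|\mu|(\zeta)}{|\zeta-z|^\tau}$, and $x_0$ is a $\tau$-spike for $A_\alpha(U)$ if $\mu^\tau(x_0)=\infty$ for every representing measure $\mu$ for $x_0$ on $A_\alpha(U)$. *)

theory Defs
  imports "HOL-Analysis.Analysis"
begin

definition Lip :: "real \<Rightarrow> (complex \<Rightarrow> complex) set" where
  "Lip \<alpha> = {f. bounded (range f) \<and>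
     (\<exists>k>0. \<forall>z w. norm (f z - f w) \<le> k * norm (z - w) powr \<alpha>)}"

definition lip :: "real \<Rightarrow> (complex \<Rightarrow> complex) set" where
  "lip \<alpha> = {f. f \<in> Lip \<alpha> \<and>
     (\<forall>\<epsilon>>0. \<exists>\<delta>>0. \<forall>z w. norm (z - w) < \<delta> \<longrightarrow>
        norm (f z - f w) \<le> \<epsilon> * norm (z - w) powr \<alpha>)}"

definition A_alpha :: "real \<Rightarrow> complex set \<Rightarrow> (complex \<Rightarrow> complex) set" where
  "A_alpha \<alpha> U = {f. f \<in> lip \<alpha> \<and> f analytic_on U}"

definition annulus :: "complex \<Rightarrow> nat \<Rightarrow> complex set" where
  "annulus x0 n = {z. 2 powr (- real n - 1) < norm (z - x0) \<and> norm (z - x0) < 2 powr (- real n)}"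

definition measure_function :: "(real \<Rightarrow> real) \<Rightarrow> bool" where
  "measure_function h \<longleftrightarrow> mono_on {0..} h \<and> (\<forall>r\<ge>0. h r \<ge> 0)"

definition M_h :: "(real \<Rightarrow> real) \<Rightarrow> complex set \<Rightarrow> ennreal" where
  "M_h h E = (INF C \<in> {C. countable C \<and> (\<forall>B\<in>C. \<exists>z r. r > 0 \<and> B = ball z r) \<and> E \<subseteq> \<Union>C}.
       (\<integral>\<^sup>+ B. ennreal (h (diameter B)) \<partial>count_space C))"

definition lower_content :: "real \<Rightarrow> complex set \<Rightarrow> ennreal" where
  "lower_content \<alpha> E = (SUP h \<in> {h. measure_function h \<and> (\<forall>r\<ge>0. h r \<le> r powr (1 + \<alpha>)) \<and>
        ((\<lambda>r. h r / r powr (1 + \<alpha>)) \<longlongrightarrow> 0) (at_right 0)}. M_h h E)"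

text \<open>A finite complex Borel measure mu is represented by its polar decomposition
  d mu = g d|mu|, with |mu| = nu a finite positive Borel measure and |g| = 1 nu-a.e.\<close>
definition complex_measure :: "complex measure \<Rightarrow> (complex \<Rightarrow> complex) \<Rightarrow> bool" where
  "complex_measure \<nu> g \<longleftrightarrow> sets \<nu> = sets borel \<and> finite_measure \<nu> \<and>
     g \<in> borel_measurable \<nu> \<and> (AE z in \<nu>. norm (g z) = 1)"

definition representing_measure ::
  "real \<Rightarrow> complex set \<Rightarrow> complex \<Rightarrow> complex measure \<Rightarrow> (complex \<Rightarrow> complex) \<Rightarrow> bool" where
  "representing_measure \<alpha> U x0 \<nu> g \<longleftrightarrow> complex_measure \<nu> g \<and>
     (\<forall>f \<in> A_alpha \<alpha> U. integrable \<nu> (\<lambda>z. f z * g z) \<and>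
        integral\<^sup>L \<nu> (\<lambda>z. f z * g z) = f x0)"

text \<open>mu^tau(z) = integral of |zeta - z|^(-tau) d|mu|(zeta), with 1/0 = infinity\<close>
definition potential :: "complex measure \<Rightarrow> real \<Rightarrow> complex \<Rightarrow> ennreal" where
  "potential \<nu> \<tau> z = (\<integral>\<^sup>+ \<zeta>. inverse (ennreal (norm (\<zeta> - z) powr \<tau>)) \<partial>\<nu>)"

definition spike :: "real \<Rightarrow> real \<Rightarrow> complex set \<Rightarrow> complex \<Rightarrow> bool" where
  "spike \<tau> \<alpha> U x0 \<longleftrightarrow> (\<forall>\<nu> g. representing_measure \<alpha> U x0 \<nu> g \<longrightarrow> potential \<nu> \<tau> x0 = \<infinity>)"

end

theory Submission
  imports Defs
begin

text \<open>
  Write \<open>s\<^sub>n\<close> for the content of the \<open>n\<close>-th annulus minus \<open>U\<close>. Frostman's lemma gives a measure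
  \<open>\<nu>\<^sub>n\<close> of mass comparable to \<open>s\<^sub>n\<close> on the closed annulus minus \<open>U\<close> whose growth is
  \<open>o(r\<^bsup>1+\<alpha>\<^esup>)\<close>: the total content is pushed down a dyadic tree so that each cell receives at most
  its own content, which is possible because the content is subadditive, and the resulting masses
  are realised by consecutive subintervals of an interval with Lebesgue measure.

  With the phase \<open>\<theta>(\<zeta>) = sgn(\<zeta> - x\<^sub>0)\<^bsup>t+1\<^esup>\<close>, the Cauchy transforms \<open>f\<^sub>n\<close> of \<open>\<theta> \<nu>\<^sub>n\<close> and \<open>G\<^sub>n\<close> of
  \<open>\<theta> (\<zeta> - x\<^sub>0)\<^bsup>-t\<^esup> \<nu>\<^sub>n\<close> belong to \<open>A\<^sub>\<alpha>(U)\<close>, and by partial fractions \<open>f\<^sub>n(z) (z - x\<^sub>0)\<^bsup>-t\<^esup>\<close> equals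
  \<open>G\<^sub>n(z)\<close> plus a combination of \<open>(z - x\<^sub>0)\<^bsup>-j\<^esup>\<close>, \<open>1 \<le> j \<le> t\<close>. Integrating against a representing
  measure \<open>\<mu>\<close> with finite potential yields \<open>G\<^sub>n(x\<^sub>0)\<close>, which is real and at least \<open>2\<^bsup>(t+1)n\<^esup> s\<^sub>n\<close>,
  up to terms smaller by a factor \<open>2\<^bsup>-n\<^esup>\<close>. On the other hand
  \<open>|f\<^sub>n(z)| \<le> C min(1, 2\<^bsup>-n\<^esup> / |z - x\<^sub>0|)\<close>, so every finite sum of the \<open>2\<^bsup>\<lambda>n\<^esup> f\<^sub>n\<close> is at most
  \<open>C |z - x\<^sub>0|\<^bsup>-\<lambda>\<^esup>\<close>. Hence the partial sums of \<open>2\<^bsup>(t+\<lambda>+1)n\<^esup> s\<^sub>n\<close> are bounded by a multiple of the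
  potential of order \<open>t + \<lambda>\<close>.
\<close>

section \<open>Distributing mass along a binary tree\<close>

text \<open>Words carry the most recent bit at the head: \<open>b # w\<close> is a child of
  \<open>w\<close>, and the suffixes of a word are its ancestors.\<close>

primrec cell :: "(nat \<Rightarrow> 'a \<Rightarrow> bool) \<Rightarrow> 'a set \<Rightarrow> bool list \<Rightarrow> 'a set" where
  "cell \<beta> K [] = K"
| "cell \<beta> K (b # w) = {z \<in> cell \<beta> K w. \<beta> (length w) z = b}"

text \<open>Greedy flow down the tree: the \<open>False\<close> child receives as much as its
  capacity \<open>H\<close> admits, the \<open>True\<close> child the remainder.\<close>

primrec mass :: "(bool list \<Rightarrow> real) \<Rightarrow> bool list \<Rightarrow> real" where
  "mass H [] = H []"
| "mass H (b # w) = (if b then mass H w - min (mass H w) (H (False # w))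
                     else min (mass H w) (H (False # w)))"

primrec left_end :: "(bool list \<Rightarrow> real) \<Rightarrow> bool list \<Rightarrow> real" where
  "left_end H [] = 0"
| "left_end H (b # w) = left_end H w + (if b then min (mass H w) (H (False # w)) else 0)"

text \<open>Half-open intervals make the slots of two siblings partition the slot of their parent
  exactly, so every point has one address at each depth.\<close>

definition slot :: "(bool list \<Rightarrow> real) \<Rightarrow> bool list \<Rightarrow> real set" where
  "slot H w = {left_end H w ..< left_end H w + mass H w}"

primrec address :: "(bool list \<Rightarrow> real) \<Rightarrow> nat \<Rightarrow> real \<Rightarrow> bool list" where
  "address H 0 x = []"
| "address H (Suc n) x = (left_end H (True # address H n x) \<le> x) # address H n x"

lemma length_address [simp]: "length (address H n x) = n"
  by (induction n) auto

lemma cell_subset: "cell \<beta> K w \<subseteq> K"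
  by (induction w) auto

lemma mem_cell_append: "z \<in> cell \<beta> K (v @ w) \<Longrightarrow> z \<in> cell \<beta> K w"
  by (induction v) auto

lemma cell_split: "cell \<beta> K w = cell \<beta> K (False # w) \<union> cell \<beta> K (True # w)"
  by auto

text \<open>Only the \<open>True\<close> child could exceed its capacity. If the
  \<open>False\<close> child is saturated, the remainder is at most
  \<open>H w - H (False # w)\<close>, which subadditivity bounds by
  \<open>H (True # w)\<close>.\<close>

lemma mass_bounds:
  assumes "\<And>w. 0 \<le> H w" and "\<And>w. H w \<le> H (False # w) + H (True # w)"
  shows "0 \<le> mass H w \<and> mass H w \<le> H w"
proof (induction w)
  case Nil
  then show ?case using assms(1) by auto
next
  case (Cons b w)
  then show ?case using assms(1)[of "False # w"] assms(1)[of "True # w"] assms(2)[of w]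
    by (cases b) auto
qed

lemma slot_Cons_subset:
  assumes "\<And>w. 0 \<le> H w" and "\<And>w. H w \<le> H (False # w) + H (True # w)"
  shows "slot H (b # w) \<subseteq> slot H w"
  using mass_bounds[OF assms, of w] assms(1)[of "False # w"]
  by (auto simp: slot_def split: if_splits)

lemma mem_slot_address:
  assumes "x \<in> slot H []"
  shows "x \<in> slot H (address H n x)"
proof (induction n)
  case 0
  then show ?case using assms by simp
next
  case (Suc n)
  then show ?case by (auto simp: slot_def)
qed

lemma address_unique:
  assumes "\<And>w. 0 \<le> H w" and "\<And>w. H w \<le> H (False # w) + H (True # w)"
    and "x \<in> slot H w"
  shows "address H (length w) x = w"
  using assms(3)
proof (induction w)
  case Nil
  then show ?case by simp
next
  case (Cons b w)
  have "x \<in> slot H w" using slot_Cons_subset[OF assms(1,2)] Cons.prems by blast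
  then have "address H (length w) x = w" using Cons.IH by simp
  then show ?case using Cons.prems by (auto simp: slot_def split: if_splits)
qed

lemma address_append:
  "m \<le> n \<Longrightarrow> \<exists>v. address H n x = v @ address H m x"
proof (induction n rule: dec_induct)
  case base
  then show ?case by simp
next
  case (step n)
  then obtain v where "address H n x = v @ address H m x" by blast
  then show ?case by (metis address.simps(2) append_Cons)
qed

lemma slot_subset_Nil:
  assumes "\<And>w. 0 \<le> H w" and "\<And>w. H w \<le> H (False # w) + H (True # w)"
  shows "slot H w \<subseteq> slot H []"
  using slot_Cons_subset[OF assms] by (induction w) blast+

text \<open>The address at depth \<open>n\<close> has countably many possible values, and the
  preimage of a word of length \<open>n\<close> is its slot, an interval.\<close>

lemma measurable_address:
  assumes "\<And>w. 0 \<le> H w" and "\<And>w. H w \<le> H (False # w) + H (True # w)"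
  shows "address H n \<in> measurable (restrict_space lborel (slot H [])) (count_space UNIV)"
proof -
  have "address H n -` {w} \<inter> slot H [] \<in> sets (restrict_space lborel (slot H []))" for w
  proof (cases "length w = n")
    case True
    have "address H n -` {w} \<inter> slot H [] = slot H w"
    proof (intro equalityI subsetI)
      fix x assume "x \<in> address H n -` {w} \<inter> slot H []"
      then show "x \<in> slot H w" using mem_slot_address[of x H n] by simp
    next
      fix x assume "x \<in> slot H w"
      then show "x \<in> address H n -` {w} \<inter> slot H []"
        using address_unique[OF assms, of x w] slot_subset_Nil[OF assms, of w] True by auto
    qed
    then show ?thesis using slot_subset_Nil[OF assms, of w]
      by (auto simp: sets_restrict_space_iff slot_def)
  next
    case False
    then have "address H n -` {w} \<inter> slot H [] = {}" by auto
    then show ?thesis by simp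
  qed
  then show ?thesis
    by (subst measurable_count_space_eq_countable) (auto simp: space_restrict_space)
qed

text \<open>The measure is the image of Lebesgue measure on the root slot under the map sending
  \<open>x\<close> to the limit of points chosen in the cells along its address. Cells need not be
  closed, so the limit may leave them; this is why the last bound counts all cells within
  \<open>\<delta> n\<close> of \<open>S\<close>.\<close>

lemma tree_mass_distribution:
  fixes K :: "'a :: {complete_space, second_countable_topology} set" and H :: "bool list \<Rightarrow> real"
  assumes H0: "\<And>w. 0 \<le> H w" and Hsub: "\<And>w. H w \<le> H (False # w) + H (True # w)"
    and Hempty: "\<And>w. cell \<beta> K w = {} \<Longrightarrow> H w = 0"
    and "closed K"
    and diam: "\<And>w y z. y \<in> cell \<beta> K w \<Longrightarrow> z \<in> cell \<beta> K w \<Longrightarrow> dist y z \<le> \<delta> (length w)"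
    and lim: "\<delta> \<longlonglongrightarrow> 0"
  obtains \<nu> :: "'a measure" where "sets \<nu> = sets borel" "finite_measure \<nu>"
    "emeasure \<nu> UNIV = ennreal (H [])" "AE z in \<nu>. z \<in> K"
    "\<And>S n. S \<in> sets borel \<Longrightarrow> emeasure \<nu> S \<le>
       ennreal (\<Sum>w | length w = n \<and> (\<exists>y\<in>cell \<beta> K w. \<exists>z\<in>S. dist y z \<le> \<delta> n). H w)"
proof -
  note mb = mass_bounds[OF H0 Hsub]
  define pt where "pt w = (SOME z. z \<in> cell \<beta> K w)" for w
  \<comment> \<open>A point in the slot forces positive mass, hence positive capacity, hence a
    nonempty cell; the choice defining \<open>pt\<close> is then meaningful.\<close>
  have pt: "pt w \<in> cell \<beta> K w" if "x \<in> slot H w" for x w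
  proof -
    have "0 < mass H w" using that by (auto simp: slot_def)
    then have "cell \<beta> K w \<noteq> {}" using Hempty mb[of w] by fastforce
    then show ?thesis unfolding pt_def by (simp add: some_in_eq)
  qed
  define q where "q n x = pt (address H n x)" for n x
  \<comment> \<open>Later cells along one address are nested in the earlier ones, so the chosen
    points form a Cauchy sequence.\<close>
  have qc: "q n x \<in> cell \<beta> K (address H m x)" if "x \<in> slot H []" "m \<le> n" for m n x
    using pt[OF mem_slot_address[OF that(1), of n]] address_append[OF that(2), of H x]
      mem_cell_append unfolding q_def by metis
  have qd: "dist (q n x) (q m x) \<le> \<delta> m" if "x \<in> slot H []" "m \<le> n" for m n x
    using diam[OF qc[OF that] qc[OF that(1) order_refl]] by simp
  have conv: "convergent (\<lambda>n. q n x)" if x: "x \<in> slot H []" for x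
  proof -
    have "Cauchy (\<lambda>n. q n x)"
    proof (rule metric_CauchyI)
      fix e :: real assume "0 < e"
      then obtain M where M: "\<And>n. n \<ge> M \<Longrightarrow> \<delta> n < e / 2"
        using order_tendstoD(2)[OF lim, of "e / 2"] by (auto simp: eventually_sequentially)
      have "dist (q m x) (q n x) < e" if "m \<ge> M" "n \<ge> M" for m n
        using qd[OF x that(1)] qd[OF x that(2)] M[of M] dist_triangle2[of "q m x" "q n x" "q M x"]
        by (simp add: dist_commute)
      then show "\<exists>M. \<forall>m\<ge>M. \<forall>n\<ge>M. dist (q m x) (q n x) < e" by blast
    qed
    then show ?thesis by (rule Cauchy_convergent)
  qed
  define p where "p x = lim (\<lambda>n. q n x)" for x
  have qp: "(\<lambda>n. q n x) \<longlonglongrightarrow> p x" if "x \<in> slot H []" for x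
    using conv[OF that] unfolding p_def by (simp add: convergent_LIMSEQ_iff)
  have pq: "dist (q n x) (p x) \<le> \<delta> n" if "x \<in> slot H []" for x n
  proof -
    have "(\<lambda>k. dist (q k x) (q n x)) \<longlonglongrightarrow> dist (p x) (q n x)"
      by (intro tendsto_dist qp that tendsto_const)
    then have "dist (p x) (q n x) \<le> \<delta> n"
      by (rule LIMSEQ_le_const2) (use qd[OF that] in blast)
    then show ?thesis by (simp add: dist_commute)
  qed
  have pK: "p x \<in> K" if "x \<in> slot H []" for x
  proof (rule closed_sequentially[OF \<open>closed K\<close> _ qp[OF that]])
    show "q n x \<in> K" for n
      using qc[OF that order_refl, of n] cell_subset[of \<beta> K "address H n x"] by blast
  qed
  define L where "L = restrict_space lborel (slot H [])"
  have spL: "space L = slot H []" by (simp add: L_def space_restrict_space)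
  have [measurable]: "p \<in> borel_measurable L"
  proof (rule borel_measurable_LIMSEQ_metric)
    show "(\<lambda>x. q n x) \<in> borel_measurable L" for n
      unfolding q_def L_def
      by (rule measurable_compose[OF measurable_address[OF H0 Hsub]]) simp
  qed (use qp spL in auto)
  define \<nu> where "\<nu> = distr L borel p"
  have slot_m: "slot H w \<in> sets lborel" for w by (simp add: slot_def)
  have eL: "emeasure L (slot H w) = ennreal (mass H w)" for w
    unfolding L_def using slot_subset_Nil[OF H0 Hsub, of w] slot_m mb[of w]
    by (subst emeasure_restrict_space) (auto simp: slot_def)
  have em: "emeasure \<nu> S = emeasure L (p -` S \<inter> slot H [])" if "S \<in> sets borel" for S
    unfolding \<nu>_def using that by (subst emeasure_distr) (auto simp: spL)
  show thesis
  proof (rule that)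
    show "sets \<nu> = sets borel" by (simp add: \<nu>_def)
    show tot: "emeasure \<nu> UNIV = ennreal (H [])" using em[of UNIV] eL[of "[]"] by simp
    show "finite_measure \<nu>"
      by (rule finite_measureI) (use tot in \<open>simp add: \<nu>_def\<close>)
    show "AE z in \<nu>. z \<in> K"
      unfolding \<nu>_def using \<open>closed K\<close> pK by (subst AE_distr_iff) (auto simp: spL borel_closed)
    fix S :: "'a set" and n assume S: "S \<in> sets borel"
    let ?W = "{w. length w = n \<and> (\<exists>y\<in>cell \<beta> K w. \<exists>z\<in>S. dist y z \<le> \<delta> n)}"
    have fin: "finite ?W"
      by (rule finite_subset[OF _ finite_lists_length_eq[of "UNIV :: bool set" n]]) auto
    \<comment> \<open>The point \<open>q n x\<close> witnesses that the cell at the address of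
      \<open>x\<close> comes within \<open>\<delta> n\<close> of \<open>p x\<close>, a point of
      \<open>S\<close>.\<close>
    have sub: "p -` S \<inter> slot H [] \<subseteq> (\<Union>w\<in>?W. slot H w)"
    proof
      fix x assume x: "x \<in> p -` S \<inter> slot H []"
      then have "address H n x \<in> ?W"
        using qc[of x n n] pq[of x n] by auto
      then show "x \<in> (\<Union>w\<in>?W. slot H w)" using mem_slot_address x by blast
    qed
    have "emeasure \<nu> S \<le> emeasure L (\<Union>w\<in>?W. slot H w)"
      unfolding em[OF S]
      by (rule emeasure_mono[OF sub])
        (use fin slot_m slot_subset_Nil[OF H0 Hsub] in
          \<open>auto simp: L_def sets_restrict_space_iff intro!: sets.finite_UN\<close>)
    also have "\<dots> \<le> (\<Sum>w\<in>?W. emeasure L (slot H w))"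
      by (rule emeasure_subadditive_finite[OF fin])
        (use slot_m slot_subset_Nil[OF H0 Hsub] in \<open>auto simp: L_def sets_restrict_space_iff\<close>)
    also have "\<dots> = ennreal (\<Sum>w\<in>?W. mass H w)"
      using mb by (simp add: eL sum_ennreal)
    also have "\<dots> \<le> ennreal (\<Sum>w\<in>?W. H w)"
      by (intro ennreal_leI sum_mono) (use mb in blast)
    finally show "emeasure \<nu> S \<le> ennreal (\<Sum>w\<in>?W. H w)" .
  qed
qed

section \<open>Contents\<close>

lemma M_h_le:
  assumes "countable C" "\<And>B. B \<in> C \<Longrightarrow> \<exists>z r. r > 0 \<and> B = ball z r" "E \<subseteq> \<Union>C"
  shows "M_h h E \<le> (\<integral>\<^sup>+ B. ennreal (h (diameter B)) \<partial>count_space C)"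
  unfolding M_h_def by (rule INF_lower) (use assms in auto)

lemma M_h_mono: "E \<subseteq> F \<Longrightarrow> M_h h E \<le> M_h h F"
  unfolding M_h_def by (rule INF_superset_mono) auto

lemma M_h_empty [simp]: "M_h h {} = 0"
  using M_h_le[of "{}" "{}" h] by (simp add: nn_integral_count_space_finite)

lemma M_h_subset_ball:
  assumes "E \<subseteq> ball z r" "r > 0"
  shows "M_h h E \<le> ennreal (h (2 * r))"
  using M_h_le[of "{ball z r}" E h] assms
  by (auto simp: nn_integral_count_space_finite diameter_ball)

text \<open>Covers of \<open>E\<close> and \<open>F\<close> that are optimal up to
  \<open>e / 2\<close> combine to a cover of the union. A ball lying in both covers is counted once
  on the left and twice on the right, whence the comparison of indicators.\<close>

lemma M_h_Un: "M_h h (E \<union> F) \<le> M_h h E + M_h h F"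
proof (rule ennreal_le_epsilon)
  fix e :: real assume fin: "M_h h E + M_h h F < top" and e: "0 < e"
  let ?I = "\<lambda>C. \<integral>\<^sup>+ B. ennreal (h (diameter B)) \<partial>count_space C"
  let ?cov = "\<lambda>E. {C. countable C \<and> (\<forall>B\<in>C. \<exists>z r. r > 0 \<and> B = ball z r) \<and> E \<subseteq> \<Union>C}"
  have ex: "\<exists>C\<in>?cov E. ?I C < M_h h E + ennreal (e / 2)" if "M_h h E < top" for E :: "complex set"
  proof -
    have "M_h h E < M_h h E + ennreal (e / 2)"
      using that e by (simp add: ennreal_add_left_cancel_less[of _ 0, simplified])
    then show ?thesis by (subst (asm) (1) M_h_def) (simp only: INF_less_iff)
  qed
  obtain C where C: "C \<in> ?cov E" "?I C < M_h h E + ennreal (e / 2)" using ex[of E] fin by force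
  obtain D where D: "D \<in> ?cov F" "?I D < M_h h F + ennreal (e / 2)" using ex[of F] fin by force
  have "M_h h (E \<union> F) \<le> ?I (C \<union> D)" by (rule M_h_le) (use C D in auto)
  also have "\<dots> \<le> ?I C + ?I D"
  proof -
    have "?I (C \<union> D) = (\<integral>\<^sup>+ B. ennreal (h (diameter B)) * indicator (C \<union> D) B \<partial>count_space UNIV)"
      by (simp add: nn_integral_count_space_indicator)
    also have "\<dots> \<le> (\<integral>\<^sup>+ B. ennreal (h (diameter B)) * indicator C B
        + ennreal (h (diameter B)) * indicator D B \<partial>count_space UNIV)"
      by (intro nn_integral_mono) (auto simp: indicator_def)
    also have "\<dots> = ?I C + ?I D"
      by (subst nn_integral_add) (auto simp: nn_integral_count_space_indicator)
    finally show ?thesis .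
  qed
  also have "\<dots> \<le> (M_h h E + ennreal (e / 2)) + (M_h h F + ennreal (e / 2))"
    using C D by (intro add_mono) auto
  also have "\<dots> = M_h h E + M_h h F + ennreal e"
  proof -
    have "ennreal e = ennreal (e / 2) + ennreal (e / 2)" using e by (subst ennreal_plus[symmetric]) auto
    then show ?thesis by (simp add: ac_simps)
  qed
  finally show "M_h h (E \<union> F) \<le> M_h h E + M_h h F + ennreal e" .
qed

section \<open>Dyadic rectangles coded by binary words, and Frostman's lemma\<close>

lemma dyadic_scale:
  assumes "0 < r" "r < (1 :: real)"
  shows "\<exists>k. (1 / 2) ^ Suc k \<le> r \<and> r < (1 / 2) ^ k"
proof -
  obtain m where "(1 / 2) ^ m < r" using real_arch_pow_inv[of r "1 / 2"] assms(1) by force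
  then have "(1 / 2) ^ m \<le> r" by (rule less_imp_le)
  moreover have "\<not> (1 / 2) ^ 0 \<le> r" using assms(2) by simp
  ultimately obtain k where "\<forall>i\<le>k. \<not> (1 / 2) ^ i \<le> r" "(1 / 2) ^ Suc k \<le> r"
    using ex_least_nat_less[of "\<lambda>k. (1 / 2) ^ k \<le> r" m] by auto
  then show ?thesis using not_le by blast
qed

text \<open>Integer coordinates of the grid rectangle containing \<open>z\<close> after
  \<open>n\<close> bisections with alternating direction, the real direction first. At even depth
  the rectangles are squares.\<close>

definition dyadic_code :: "complex \<Rightarrow> nat \<Rightarrow> complex \<Rightarrow> int \<times> int" where
  "dyadic_code c n z = (\<lfloor>2 ^ (Suc n div 2) * Re (z - c)\<rfloor>, \<lfloor>2 ^ (n div 2) * Im (z - c)\<rfloor>)"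

text \<open>The half chosen by the next bisection: the last binary digit of the coordinate that is
  refined in passing from depth \<open>n\<close> to depth \<open>Suc n\<close>.\<close>

definition dyadic_bit :: "complex \<Rightarrow> nat \<Rightarrow> complex \<Rightarrow> bool" where
  "dyadic_bit c n z \<longleftrightarrow>
     odd \<lfloor>2 ^ Suc (n div 2) * (if even n then Re (z - c) else Im (z - c))\<rfloor>"

definition unit_square :: "complex \<Rightarrow> complex set" where
  "unit_square c = {z. 0 \<le> Re (z - c) \<and> Re (z - c) < 1 \<and> 0 \<le> Im (z - c) \<and> Im (z - c) < 1}"

lemma floor_double_div_2: "\<lfloor>2 * x\<rfloor> div 2 = \<lfloor>x :: real\<rfloor>"
  using floor_divide_real_eq_div[of 2 "2 * x"] by simp

lemma int_eq_iff_half_parity: "a = b \<longleftrightarrow> a div 2 = b div 2 \<and> odd a = odd (b :: int)"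
  by presburger

text \<open>Refinement changes one coordinate only, and the refined floor is determined by its half,
  which is the old floor, together with its parity, which is the new bit.\<close>

lemma dyadic_code_Suc_eq_iff:
  "dyadic_code c (Suc n) y = dyadic_code c (Suc n) z \<longleftrightarrow>
     dyadic_code c n y = dyadic_code c n z \<and> dyadic_bit c n y = dyadic_bit c n z"
proof -
  have double: "\<lfloor>2 ^ Suc k * u\<rfloor> = \<lfloor>2 ^ Suc k * v\<rfloor> \<longleftrightarrow>
      \<lfloor>2 ^ k * u\<rfloor> = \<lfloor>2 ^ k * v\<rfloor> \<and> odd \<lfloor>2 ^ Suc k * u\<rfloor> = odd \<lfloor>2 ^ Suc k * v\<rfloor>"
    for k and u v :: real
    using int_eq_iff_half_parity[of "\<lfloor>2 ^ Suc k * u\<rfloor>" "\<lfloor>2 ^ Suc k * v\<rfloor>"]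
      floor_double_div_2[of "2 ^ k * u"] floor_double_div_2[of "2 ^ k * v"]
    by (simp add: mult.assoc)
  show ?thesis
  proof (cases "even n")
    case True
    then obtain k where k: "n = 2 * k" by blast
    show ?thesis using double[of k "Re (y - c)" "Re (z - c)"]
      by (auto simp: dyadic_code_def dyadic_bit_def k simp del: power_Suc)
  next
    case False
    then obtain k where k: "n = Suc (2 * k)" by (auto elim: oddE)
    show ?thesis using double[of k "Im (y - c)" "Im (z - c)"]
      by (auto simp: dyadic_code_def dyadic_bit_def k simp del: power_Suc)
  qed
qed

text \<open>Links the abstract tree to the grid. Inside the unit square all codes of depth zero are
  \<open>(0, 0)\<close>, so the bits along a word carry the same information as the code.\<close>

lemma dyadic_cell_eq_iff:
  assumes K: "K \<subseteq> unit_square c"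
  shows "length v = length w \<Longrightarrow> y \<in> cell (dyadic_bit c) K v \<Longrightarrow> z \<in> cell (dyadic_bit c) K w \<Longrightarrow>
     v = w \<longleftrightarrow> dyadic_code c (length w) y = dyadic_code c (length w) z"
proof (induction v w rule: list_induct2)
  case Nil
  then have "y \<in> K" "z \<in> K" by auto
  then have "\<lfloor>Re (y - c)\<rfloor> = 0" "\<lfloor>Re (z - c)\<rfloor> = 0" "\<lfloor>Im (y - c)\<rfloor> = 0" "\<lfloor>Im (z - c)\<rfloor> = 0"
    using K unfolding unit_square_def floor_eq_iff by auto
  then show ?case by (simp add: dyadic_code_def del: minus_complex.sel)
next
  case (Cons a v b w)
  then show ?case by (auto simp: dyadic_code_Suc_eq_iff)
qed

lemma floor_scaled_eq_imp_diff:
  assumes "\<lfloor>2 ^ m * u\<rfloor> = \<lfloor>2 ^ m * (v :: real)\<rfloor>" "k \<le> m"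
  shows "\<bar>u - v\<bar> < (1 / 2) ^ k"
proof -
  have "\<bar>2 ^ m * u - 2 ^ m * v\<bar> < 1" using assms(1) by linarith
  then have "2 ^ m * \<bar>u - v\<bar> < 1" by (simp add: abs_mult flip: right_diff_distrib)
  then have "\<bar>u - v\<bar> < (1 / 2) ^ m" by (simp add: field_simps)
  also have "\<dots> \<le> (1 / 2) ^ k" using assms(2) by (intro power_decreasing) auto
  finally show ?thesis .
qed

text \<open>Both sides of a rectangle of depth \<open>n\<close> are at most
  \<open>(1 / 2) ^ (n div 2)\<close>; the factor 2 adds the two coordinates.\<close>

lemma dist_less_of_dyadic_code_eq:
  assumes "dyadic_code c n y = dyadic_code c n z"
  shows "dist y z < 2 * (1 / 2) ^ (n div 2)"
proof -
  have "\<bar>Re (y - c) - Re (z - c)\<bar> < (1 / 2) ^ (n div 2)"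
    by (rule floor_scaled_eq_imp_diff[of "Suc n div 2"])
      (use assms in \<open>auto simp: dyadic_code_def\<close>)
  moreover have "\<bar>Im (y - c) - Im (z - c)\<bar> < (1 / 2) ^ (n div 2)"
    by (rule floor_scaled_eq_imp_diff[of "n div 2"])
      (use assms in \<open>auto simp: dyadic_code_def\<close>)
  moreover have "dist y z \<le> \<bar>Re (y - z)\<bar> + \<bar>Im (y - z)\<bar>"
    unfolding dist_norm by (rule cmod_le)
  ultimately show ?thesis by simp
qed

text \<open>At depth \<open>2 * k\<close> the cells lie in squares of side
  \<open>(1 / 2) ^ k\<close>. A cell that comes this close to \<open>z\<close> has each code
  coordinate within 3 of that of \<open>z\<close>, leaving 7 * 7 possibilities.\<close>

lemma card_dyadic_cells_near:
  assumes K: "K \<subseteq> unit_square c"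
  shows "card {w. length w = 2 * k \<and> (\<exists>y\<in>cell (dyadic_bit c) K w. dist y z \<le> 3 * (1 / 2) ^ k)} \<le> 49"
proof -
  let ?W = "{w. length w = 2 * k \<and> (\<exists>y\<in>cell (dyadic_bit c) K w. dist y z \<le> 3 * (1 / 2) ^ k)}"
  define near_pt where "near_pt w y \<longleftrightarrow> y \<in> cell (dyadic_bit c) K w \<and> dist y z \<le> 3 * (1 / 2) ^ k" for w y
  define pt where "pt w = (SOME y. near_pt w y)" for w
  have pt: "pt w \<in> cell (dyadic_bit c) K w \<and> dist (pt w) z \<le> 3 * (1 / 2) ^ k" if "w \<in> ?W" for w
  proof -
    have "\<exists>y. near_pt w y" using that by (auto simp: near_pt_def)
    then have "near_pt w (pt w)" unfolding pt_def by (rule someI_ex)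
    then show ?thesis by (simp add: near_pt_def)
  qed
  define I where "I = {\<lfloor>2 ^ k * Re (z - c)\<rfloor> - 3 .. \<lfloor>2 ^ k * Re (z - c)\<rfloor> + 3}
    \<times> {\<lfloor>2 ^ k * Im (z - c)\<rfloor> - 3 .. \<lfloor>2 ^ k * Im (z - c)\<rfloor> + 3}"
  have near: "\<lfloor>2 ^ k * u\<rfloor> \<in> {\<lfloor>2 ^ k * v\<rfloor> - 3 .. \<lfloor>2 ^ k * v\<rfloor> + 3}"
    if "\<bar>u - v\<bar> \<le> 3 * (1 / 2) ^ k" for u v :: real
  proof -
    have "2 ^ k * \<bar>u - v\<bar> \<le> 2 ^ k * (3 * (1 / 2) ^ k)" using that by (intro mult_left_mono) auto
    also have "\<dots> = 3" by (simp add: power_divide)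
    finally have "\<bar>2 ^ k * u - 2 ^ k * v\<bar> \<le> 3" by (simp add: abs_mult flip: right_diff_distrib)
    then show ?thesis unfolding atLeastAtMost_iff by linarith
  qed
  have "dyadic_code c (2 * k) (pt w) \<in> I" if "w \<in> ?W" for w
  proof -
    have "\<bar>Re (pt w - z)\<bar> \<le> 3 * (1 / 2) ^ k" "\<bar>Im (pt w - z)\<bar> \<le> 3 * (1 / 2) ^ k"
      using pt[OF that] abs_Re_le_cmod[of "pt w - z"] abs_Im_le_cmod[of "pt w - z"]
      by (auto simp: dist_norm)
    then show ?thesis
      using near[of "Re (pt w - c)" "Re (z - c)"] near[of "Im (pt w - c)" "Im (z - c)"]
      by (auto simp: I_def dyadic_code_def)
  qed
  moreover have "inj_on (\<lambda>w. dyadic_code c (2 * k) (pt w)) ?W"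
  proof (rule inj_onI)
    fix v w assume "v \<in> ?W" "w \<in> ?W" "dyadic_code c (2 * k) (pt v) = dyadic_code c (2 * k) (pt w)"
    then show "v = w" using pt[of v] pt[of w] dyadic_cell_eq_iff[OF K, of v w "pt v" "pt w"] by auto
  qed
  moreover have "finite I" by (simp add: I_def)
  ultimately have "card ?W \<le> card I"
    by (intro card_inj_on_le[of "\<lambda>w. dyadic_code c (2 * k) (pt w)"]) (auto simp: image_subset_iff)
  also have "card I = 49" by (simp add: I_def)
  finally show ?thesis .
qed

text \<open>The capacity of a cell is its own content: it is subadditive over the two children and
  vanishes on empty cells. A ball of radius \<open>r\<close> meets the influence of at most 49 cells
  of comparable size, each of which lies in a ball of diameter at most \<open>8 * r\<close>.\<close>

theorem frostman:
  fixes K :: "complex set"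
  assumes "compact K"
    and K: "K \<subseteq> unit_square c"
    and h: "measure_function h"
  obtains \<nu> :: "complex measure" where "sets \<nu> = sets borel" "finite_measure \<nu>"
    "emeasure \<nu> UNIV = M_h h K" "AE z in \<nu>. z \<in> K"
    "\<And>z r. 0 < r \<Longrightarrow> emeasure \<nu> (cball z r) \<le> ennreal (49 * h (8 * r))"
proof -
  have mono: "h r \<le> h s" if "0 \<le> r" "r \<le> s" for r s
    using h that by (auto simp: measure_function_def mono_on_def)
  have nonneg: "0 \<le> h r" if "0 \<le> r" for r using h that by (auto simp: measure_function_def)
  let ?cell = "cell (dyadic_bit c) K"
  have K_ball: "K \<subseteq> ball c 2"
  proof
    fix z assume "z \<in> K"
    then have "\<bar>Re (z - c)\<bar> + \<bar>Im (z - c)\<bar> < 2" using K unfolding unit_square_def by fastforce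
    then have "cmod (z - c) < 2" using cmod_le[of "z - c"] by linarith
    then show "z \<in> ball c 2" by (simp add: dist_norm norm_minus_commute)
  qed
  have MK: "M_h h K \<le> ennreal (h 4)" using M_h_subset_ball[OF K_ball, of h] by simp
  have M_top: "M_h h (?cell w) < top" for w
  proof -
    have "M_h h (?cell w) \<le> ennreal (h 4)" using M_h_mono[OF cell_subset] MK by (rule order_trans)
    then show ?thesis by (simp add: le_less_trans)
  qed
  define H where "H w = enn2real (M_h h (?cell w))" for w
  have ennH: "ennreal (H w) = M_h h (?cell w)" for w using M_top by (simp add: H_def)
  have cell_diam: "dist y z < 2 * (1 / 2) ^ (length w div 2)" if "y \<in> ?cell w" "z \<in> ?cell w" for w y z
    using dyadic_cell_eq_iff[OF K, of w w y z] that by (intro dist_less_of_dyadic_code_eq) auto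
  have H0: "0 \<le> H w" for w by (simp add: H_def)
  have Hsub: "H w \<le> H (False # w) + H (True # w)" for w
  proof -
    have "ennreal (H w) \<le> ennreal (H (False # w)) + ennreal (H (True # w))"
      unfolding ennH using M_h_Un[of h "?cell (False # w)" "?cell (True # w)"]
      by (simp only: cell_split[symmetric])
    then show ?thesis using H0 by (simp flip: ennreal_plus)
  qed
  have Hempty: "H w = 0" if "?cell w = {}" for w using that by (simp add: H_def)
  have lim: "(\<lambda>n. 2 * (1 / 2) ^ (n div 2) :: real) \<longlonglongrightarrow> 0"
  proof -
    have "filterlim (\<lambda>n::nat. n div 2) sequentially sequentially"
      unfolding filterlim_at_top eventually_sequentially
    proof
      show "\<exists>N. \<forall>n\<ge>N. Z \<le> n div 2" for Z :: nat by (rule exI[of _ "2 * Z"]) auto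
    qed
    then have "(\<lambda>n. (1 / 2 :: real) ^ (n div 2)) \<longlonglongrightarrow> 0"
      by (rule filterlim_compose[rotated]) (simp add: LIMSEQ_power_zero)
    from tendsto_mult_right_zero[OF this, of 2] show ?thesis by simp
  qed
  obtain \<nu> where \<nu>: "sets \<nu> = sets borel" "finite_measure \<nu>"
    "emeasure \<nu> UNIV = ennreal (H [])" "AE z in \<nu>. z \<in> K"
    "\<And>S n. S \<in> sets borel \<Longrightarrow> emeasure \<nu> S \<le>
       ennreal (\<Sum>w | length w = n \<and> (\<exists>y\<in>?cell w. \<exists>z\<in>S. dist y z \<le> 2 * (1 / 2) ^ (n div 2)). H w)"
    apply (rule tree_mass_distribution[of H "dyadic_bit c" K "\<lambda>n. 2 * (1 / 2) ^ (n div 2)", OF H0 Hsub])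
        apply (erule Hempty)
       apply (rule compact_imp_closed[OF \<open>compact K\<close>])
      apply (rule less_imp_le, erule (1) cell_diam)
     apply (rule lim)
    apply (rule that)
    by assumption
  have tot: "emeasure \<nu> UNIV = M_h h K" using \<nu>(3) ennH[of "[]"] by simp
  have "emeasure \<nu> (cball z r) \<le> ennreal (49 * h (8 * r))" if r: "0 < r" for z r
  proof (cases "1 \<le> r")
    case True
    \<comment> \<open>For large radii the total mass suffices, as \<open>K\<close> lies in a ball of
      diameter 4.\<close>
    have "emeasure \<nu> (cball z r) \<le> emeasure \<nu> UNIV" using \<nu>(1) by (intro emeasure_mono) auto
    also have "\<dots> \<le> ennreal (h 4)" using tot MK by simp
    also have "\<dots> \<le> ennreal (49 * h (8 * r))"
      using mono[of 4 "8 * r"] nonneg[of "8 * r"] True by (intro ennreal_leI) simp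
    finally show ?thesis .
  next
    case False
    obtain k where k: "(1 / 2) ^ Suc k \<le> r" "r < (1 / 2) ^ k"
      using dyadic_scale[of r] r False by fastforce
    define s where "s = (1 / 2 :: real) ^ k"
    have s: "s \<le> 2 * r" "r < s" "0 < s" using k by (auto simp: s_def)
    let ?W = "{w. length w = 2 * k \<and> (\<exists>y\<in>?cell w. \<exists>z'\<in>cball z r. dist y z' \<le> 2 * (1 / 2) ^ (2 * k div 2))}"
    let ?W' = "{w. length w = 2 * k \<and> (\<exists>y\<in>?cell w. dist y z \<le> 3 * (1 / 2) ^ k)}"
    \<comment> \<open>The radius \<open>r < s\<close> and the displacement \<open>2 * s\<close> add
      up to the radius \<open>3 * s\<close> of the counting lemma.\<close>
    have "?W \<subseteq> ?W'"
    proof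
      fix w assume "w \<in> ?W"
      then obtain y z' where *: "length w = 2 * k" "y \<in> ?cell w" "dist z z' \<le> r" "dist y z' \<le> 2 * s"
        by (auto simp: s_def)
      then have "dist y z \<le> 3 * (1 / 2) ^ k" using dist_triangle2[of y z z'] s by (simp flip: s_def)
      with * show "w \<in> ?W'" by blast
    qed
    moreover have "finite ?W'"
      by (rule finite_subset[OF _ finite_lists_length_eq[of "UNIV :: bool set" "2 * k"]]) auto
    ultimately have "card ?W \<le> card ?W'" by (rule card_mono[rotated])
    then have card: "card ?W \<le> 49" using card_dyadic_cells_near[OF K, where k = k and z = z] by linarith
    have Hw: "H w \<le> h (8 * r)" if "w \<in> ?W" for w
    proof -
      from that obtain y where y: "y \<in> ?cell w" and len: "length w = 2 * k" by blast
      \<comment> \<open>This ball has diameter \<open>4 * s\<close>, which is at most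
        \<open>8 * r\<close> because \<open>s \<le> 2 * r\<close>.\<close>
      have "?cell w \<subseteq> ball y (2 * s)" using cell_diam[OF y] len by (auto simp: s_def)
      then have "M_h h (?cell w) \<le> ennreal (h (2 * (2 * s)))"
        using s by (intro M_h_subset_ball) auto
      then have "ennreal (H w) \<le> ennreal (h (2 * (2 * s)))" by (simp only: ennH)
      then have "H w \<le> h (2 * (2 * s))" using nonneg s by simp
      also have "\<dots> \<le> h (8 * r)" using s by (intro mono) auto
      finally show ?thesis .
    qed
    have "emeasure \<nu> (cball z r) \<le> ennreal (\<Sum>w\<in>?W. H w)" by (rule \<nu>(5)) simp
    also have "(\<Sum>w\<in>?W. H w) \<le> of_nat (card ?W) * h (8 * r)" by (rule sum_bounded_above) (rule Hw)
    also have "\<dots> \<le> 49 * h (8 * r)" using card nonneg[of "8 * r"] r by (intro mult_right_mono) auto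
    finally show ?thesis by (simp add: ennreal_leI)
  qed
  from that[OF \<nu>(1,2) tot \<nu>(4) this] show thesis .
qed

section \<open>Cauchy transforms of measures with small growth\<close>

text \<open>The function \<open>u\<close> is dominated by the sum of \<open>c j\<close> times the
  indicator of \<open>B j\<close>. The layers may overlap, so whole balls can be used instead of
  shells.\<close>

lemma nn_integral_le_layers:
  fixes c m :: "nat \<Rightarrow> real"
  assumes B: "\<And>j. B j \<in> sets M" and m: "\<And>j. emeasure M (B j) \<le> ennreal (m j)"
    and u: "\<And>x. x \<in> space M \<Longrightarrow> u x \<noteq> 0 \<Longrightarrow> \<exists>j. x \<in> B j \<and> u x \<le> ennreal (c j)"
    and nonneg: "\<And>j. 0 \<le> c j" "\<And>j. 0 \<le> m j" and T: "(\<lambda>j. c j * m j) sums T"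
  shows "(\<integral>\<^sup>+ x. u x \<partial>M) \<le> ennreal T"
proof -
  have "(\<integral>\<^sup>+ x. u x \<partial>M) \<le> (\<integral>\<^sup>+ x. (\<Sum>j. ennreal (c j) * indicator (B j) x) \<partial>M)"
  proof (rule nn_integral_mono)
    fix x assume x: "x \<in> space M"
    show "u x \<le> (\<Sum>j. ennreal (c j) * indicator (B j) x)"
    proof (cases "u x = 0")
      case False
      then obtain j where j: "x \<in> B j" "u x \<le> ennreal (c j)" using u x by blast
      then have "u x \<le> (\<Sum>i\<in>{j}. ennreal (c i) * indicator (B i) x)" by simp
      also have "\<dots> \<le> (\<Sum>j. ennreal (c j) * indicator (B j) x)" by (intro sum_le_suminf) auto
      finally show ?thesis .
    qed simp
  qed
  also have "\<dots> = (\<Sum>j. \<integral>\<^sup>+ x. ennreal (c j) * indicator (B j) x \<partial>M)"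
    using B by (intro nn_integral_suminf) auto
  also have "\<dots> = (\<Sum>j. ennreal (c j) * emeasure M (B j))"
    using B by (simp add: nn_integral_cmult_indicator)
  also have "\<dots> \<le> (\<Sum>j. ennreal (c j * m j))"
    using m nonneg by (intro suminf_le) (auto simp: ennreal_mult intro!: mult_left_mono)
  also have "\<dots> = ennreal T"
    using T nonneg by (intro suminf_ennreal_eq) auto
  finally show ?thesis .
qed

section \<open>Potentials of measures with power growth\<close>

lemma powr_neg_less_1: "0 < a \<Longrightarrow> 2 powr (- a) < (1 :: real)"
  using powr_less_mono[of "- a" 0 2] by simp

text \<open>Dyadic shells shrinking to \<open>z\<close>: the kernel is at most
  \<open>2 ^ Suc j / d\<close> on the shell number \<open>j\<close>, the growth bound controls its
  mass, and the products form a geometric series of ratio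
  \<open>2 powr (- \<alpha>)\<close>.\<close>

lemma near_potential_bound:
  fixes \<nu> :: "complex measure"
  assumes \<nu>: "sets \<nu> = sets borel" and "0 < \<alpha>" "0 \<le> C" "0 < d"
    and growth: "\<And>r. 0 < r \<Longrightarrow> r \<le> d \<Longrightarrow> emeasure \<nu> (cball z r) \<le> ennreal (C * r powr (1 + \<alpha>))"
  shows "(\<integral>\<^sup>+ \<zeta>. ennreal (1 / cmod (\<zeta> - z)) * indicator (cball z d) \<zeta> \<partial>\<nu>)
    \<le> ennreal (2 * C / (1 - 2 powr (- \<alpha>)) * d powr \<alpha>)"
proof (rule nn_integral_le_layers[where B = "\<lambda>j. cball z (d * (1 / 2) ^ j)" and c = "\<lambda>j. 2 ^ Suc j / d"
      and m = "\<lambda>j. C * (d * (1 / 2) ^ j) powr (1 + \<alpha>)"])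
  show "cball z (d * (1 / 2) ^ j) \<in> sets \<nu>" for j using \<nu> by simp
  show "emeasure \<nu> (cball z (d * (1 / 2) ^ j)) \<le> ennreal (C * (d * (1 / 2) ^ j) powr (1 + \<alpha>))" for j
    using \<open>0 < d\<close> power_le_one[of "1 / 2 :: real" j] by (intro growth) (auto simp: mult_le_cancel_left1)
  \<comment> \<open>A nonzero integrand excludes \<open>\<zeta> = z\<close>, where the quotient
    takes the default value 0.\<close>
  fix \<zeta> assume "ennreal (1 / cmod (\<zeta> - z)) * indicator (cball z d) \<zeta> \<noteq> 0"
  then have \<zeta>: "\<zeta> \<in> cball z d" "\<zeta> \<noteq> z" by (auto simp: indicator_def split: if_splits)
  define a where "a = cmod (\<zeta> - z)"
  have a: "0 < a" "a \<le> d" using \<zeta> by (auto simp: a_def dist_norm norm_minus_commute)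
  \<comment> \<open>The boundary value \<open>a = d\<close> is treated apart, because
    \<open>dyadic_scale\<close> needs a ratio strictly below 1.\<close>
  have "\<exists>j. d * (1 / 2) ^ Suc j \<le> a \<and> a \<le> d * (1 / 2) ^ j"
  proof (cases "a = d")
    case True
    then show ?thesis using a by (intro exI[of _ 0]) auto
  next
    case False
    then have "0 < a / d" "a / d < 1" using a \<open>0 < d\<close> by auto
    then obtain j where "(1 / 2) ^ Suc j \<le> a / d" "a / d < (1 / 2) ^ j" using dyadic_scale by blast
    then show ?thesis using \<open>0 < d\<close> by (intro exI[of _ j]) (simp add: field_simps)
  qed
  then obtain j where j: "d * (1 / 2) ^ Suc j \<le> a" "a \<le> d * (1 / 2) ^ j" by blast
  have "1 / a \<le> 1 / (d * (1 / 2) ^ Suc j)" using j(1) \<open>0 < d\<close> by (intro divide_left_mono) (auto simp: a)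
  also have "\<dots> = 2 ^ Suc j / d" by (simp add: power_divide)
  finally have "1 / a \<le> 2 ^ Suc j / d" .
  then show "\<exists>j. \<zeta> \<in> cball z (d * (1 / 2) ^ j) \<and>
      ennreal (1 / cmod (\<zeta> - z)) * indicator (cball z d) \<zeta> \<le> ennreal (2 ^ Suc j / d)"
    using \<zeta> j(2) by (intro exI[of _ j]) (auto simp: a_def dist_norm norm_minus_commute ennreal_leI)
next
  have "2 ^ Suc j / d * (C * (d * (1 / 2) ^ j) powr (1 + \<alpha>)) = 2 * C * d powr \<alpha> * (2 powr (- \<alpha>)) ^ j" for j
  proof -
    have "(d * (1 / 2) ^ j) powr (1 + \<alpha>) = d * (1 / 2) ^ j * (d powr \<alpha> * ((1 / 2) ^ j) powr \<alpha>)"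
      using \<open>0 < d\<close> by (simp add: powr_add powr_mult)
    moreover have "((1 / 2 :: real) ^ j) powr \<alpha> = (2 powr (- \<alpha>)) ^ j"
      by (simp add: powr_minus power_one_over powr_power powr_powr inverse_eq_divide powr_divide mult.commute
          flip: powr_realpow)
    ultimately show ?thesis using \<open>0 < d\<close> by (simp add: power_divide)
  qed
  moreover have "(\<lambda>j. 2 * C * d powr \<alpha> * (2 powr (- \<alpha>)) ^ j) sums (2 * C * d powr \<alpha> * (1 / (1 - 2 powr (- \<alpha>))))"
    using powr_neg_less_1[OF \<open>0 < \<alpha>\<close>] by (intro sums_mult geometric_sums) auto
  ultimately show "(\<lambda>j. 2 ^ Suc j / d * (C * (d * (1 / 2) ^ j) powr (1 + \<alpha>)))
      sums (2 * C / (1 - 2 powr (- \<alpha>)) * d powr \<alpha>)"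
    by (simp add: field_simps)
qed (use assms in auto)

text \<open>Now the shells expand from radius \<open>d\<close>. The squared kernel gives the ratio
  \<open>2 powr (- (1 - \<alpha>))\<close>, which is below 1 because
  \<open>\<alpha> < 1\<close>.\<close>

lemma far_potential_bound:
  fixes \<nu> :: "complex measure"
  assumes \<nu>: "sets \<nu> = sets borel" and "0 < \<alpha>" "\<alpha> < 1" "0 \<le> C" "0 < d" "0 < \<rho>"
    and growth: "\<And>r. 0 < r \<Longrightarrow> r \<le> \<rho> \<Longrightarrow> emeasure \<nu> (cball z r) \<le> ennreal (C * r powr (1 + \<alpha>))"
  shows "(\<integral>\<^sup>+ \<zeta>. ennreal (1 / (cmod (\<zeta> - z))\<^sup>2) * indicator (cball z \<rho> - cball z d) \<zeta> \<partial>\<nu>)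
    \<le> ennreal (4 * C / (1 - 2 powr (- (1 - \<alpha>))) * d powr (\<alpha> - 1))"
proof (rule nn_integral_le_layers[where B = "\<lambda>j. cball z (d * 2 ^ Suc j) \<inter> cball z \<rho>"
      and c = "\<lambda>j. 1 / (d * 2 ^ j)\<^sup>2" and m = "\<lambda>j. C * 4 * (d * 2 ^ j) powr (1 + \<alpha>)"])
  show "cball z (d * 2 ^ Suc j) \<inter> cball z \<rho> \<in> sets \<nu>" for j using \<nu> by simp
  show "emeasure \<nu> (cball z (d * 2 ^ Suc j) \<inter> cball z \<rho>) \<le> ennreal (C * 4 * (d * 2 ^ j) powr (1 + \<alpha>))" for j
  proof -
    \<comment> \<open>Growth is available only up to radius \<open>\<rho>\<close>, so the doubled
      ball is truncated there before its mass is estimated.\<close>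
    define r where "r = min (d * 2 ^ Suc j) \<rho>"
    have r: "0 < r" "r \<le> \<rho>" "r \<le> 2 * (d * 2 ^ j)" using assms by (auto simp: r_def)
    have "cball z (d * 2 ^ Suc j) \<inter> cball z \<rho> = cball z r" by (auto simp: r_def)
    then have "emeasure \<nu> (cball z (d * 2 ^ Suc j) \<inter> cball z \<rho>) \<le> ennreal (C * r powr (1 + \<alpha>))"
      using growth r by simp
    also have "C * r powr (1 + \<alpha>) \<le> C * (2 * (d * 2 ^ j)) powr (1 + \<alpha>)"
      using r assms by (intro mult_left_mono powr_mono2) auto
    also have "\<dots> = C * (2 powr (1 + \<alpha>) * (d * 2 ^ j) powr (1 + \<alpha>))" using assms by (simp add: powr_mult)
    also have "\<dots> \<le> C * (4 * (d * 2 ^ j) powr (1 + \<alpha>))"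
      using assms powr_mono[of "1 + \<alpha>" 2 2] by (intro mult_left_mono mult_right_mono) auto
    finally show ?thesis by (simp add: ennreal_leI mult.assoc)
  qed
  fix \<zeta> assume "ennreal (1 / (cmod (\<zeta> - z))\<^sup>2) * indicator (cball z \<rho> - cball z d) \<zeta> \<noteq> 0"
  then have \<zeta>: "\<zeta> \<in> cball z \<rho>" "\<zeta> \<notin> cball z d" by (auto simp: indicator_def split: if_splits)
  define a where "a = cmod (\<zeta> - z)"
  have a: "0 < a" "d < a" using \<zeta> \<open>0 < d\<close> by (auto simp: a_def dist_norm norm_minus_commute)
  have "0 < d / a" "d / a < 1" using a \<open>0 < d\<close> by auto
  then obtain j where "(1 / 2) ^ Suc j \<le> d / a" "d / a < (1 / 2) ^ j" using dyadic_scale by blast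
  then have j: "d * 2 ^ j \<le> a" "a \<le> d * 2 ^ Suc j" using a by (auto simp: field_simps power_divide)
  have "1 / a\<^sup>2 \<le> 1 / (d * 2 ^ j)\<^sup>2" using j(1) \<open>0 < d\<close> a by (intro divide_left_mono power_mono) auto
  then show "\<exists>j. \<zeta> \<in> cball z (d * 2 ^ Suc j) \<inter> cball z \<rho> \<and>
      ennreal (1 / (cmod (\<zeta> - z))\<^sup>2) * indicator (cball z \<rho> - cball z d) \<zeta> \<le> ennreal (1 / (d * 2 ^ j)\<^sup>2)"
    using \<zeta> j(2) by (intro exI[of _ j]) (auto simp: a_def dist_norm norm_minus_commute ennreal_leI)
next
  have "1 / (d * 2 ^ j)\<^sup>2 * (C * 4 * (d * 2 ^ j) powr (1 + \<alpha>))
      = 4 * C * d powr (\<alpha> - 1) * (2 powr (- (1 - \<alpha>))) ^ j" for j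
  proof -
    have "1 / (d * 2 ^ j)\<^sup>2 = (d * 2 ^ j) powr (- 2)" using \<open>0 < d\<close> by (simp add: powr_minus_divide)
    then have "1 / (d * 2 ^ j)\<^sup>2 * (d * 2 ^ j) powr (1 + \<alpha>) = (d * 2 ^ j) powr (\<alpha> - 1)"
      using \<open>0 < d\<close> by (simp flip: powr_add)
    also have "\<dots> = d powr (\<alpha> - 1) * (2 ^ j) powr (\<alpha> - 1)" using \<open>0 < d\<close> by (simp add: powr_mult)
    also have "(2 ^ j :: real) powr (\<alpha> - 1) = (2 powr (- (1 - \<alpha>))) ^ j"
      by (simp add: powr_power powr_powr mult.commute flip: powr_realpow)
    finally have "1 / (d * 2 ^ j)\<^sup>2 * (d * 2 ^ j) powr (1 + \<alpha>)
        = d powr (\<alpha> - 1) * (2 powr (- (1 - \<alpha>))) ^ j" .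
    moreover have "1 / (d * 2 ^ j)\<^sup>2 * (C * 4 * (d * 2 ^ j) powr (1 + \<alpha>))
        = 4 * C * (1 / (d * 2 ^ j)\<^sup>2 * (d * 2 ^ j) powr (1 + \<alpha>))" by simp
    ultimately show ?thesis by (simp only: mult.assoc)
  qed
  moreover have "(\<lambda>j. 4 * C * d powr (\<alpha> - 1) * (2 powr (- (1 - \<alpha>))) ^ j)
      sums (4 * C * d powr (\<alpha> - 1) * (1 / (1 - 2 powr (- (1 - \<alpha>)))))"
    using powr_neg_less_1[of "1 - \<alpha>"] assms by (intro sums_mult geometric_sums) auto
  ultimately show "(\<lambda>j. 1 / (d * 2 ^ j)\<^sup>2 * (C * 4 * (d * 2 ^ j) powr (1 + \<alpha>)))
      sums (4 * C / (1 - 2 powr (- (1 - \<alpha>))) * d powr (\<alpha> - 1))"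
    by (simp add: field_simps)
qed (use assms in auto)

section \<open>Differences of Cauchy kernels, and analyticity of Cauchy transforms\<close>

definition cauchy_transform :: "complex measure \<Rightarrow> (complex \<Rightarrow> complex) \<Rightarrow> complex \<Rightarrow> complex" where
  "cauchy_transform \<nu> \<phi> z = (LINT \<zeta>|\<nu>. \<phi> \<zeta> / (\<zeta> - z))"

text \<open>Includes the junk case \<open>\<zeta> = z\<close> or \<open>\<zeta> = w\<close>, where one of the reciprocals is \<open>0\<close>.\<close>
lemma norm_diff_reciprocals_le:
  fixes z w \<zeta> :: complex
  assumes "z \<noteq> w" and "cmod (\<zeta> - z) \<le> cmod (\<zeta> - w)"
  shows "cmod (1 / (\<zeta> - z) - 1 / (\<zeta> - w)) \<le>
    2 * (1 / cmod (\<zeta> - z) * indicator (cball z (cmod (z - w))) \<zeta>)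
      + cmod (z - w) * (1 / (cmod (\<zeta> - z))\<^sup>2 * indicator (- cball z (cmod (z - w))) \<zeta>)
      + 2 * (1 / cmod (\<zeta> - w) * indicator (cball w (cmod (z - w))) \<zeta>)"
proof -
  define a b d where "a = cmod (\<zeta> - z)" and "b = cmod (\<zeta> - w)" and "d = cmod (z - w)"
  have d: "0 < d" "a \<le> b" using assms by (auto simp: a_def b_def d_def)
  \<comment> \<open>Since \<open>w\<close> is the point farther from \<open>\<zeta>\<close>, its
    distance \<open>b\<close> is at least \<open>d / 2\<close>; this turns
    \<open>d / (a * b)\<close> into at most \<open>2 / a\<close>.\<close>
  have "d \<le> a + b" using norm_triangle_ineq4[of "\<zeta> - w" "\<zeta> - z"] by (simp add: a_def b_def d_def)
  then have b: "d / 2 \<le> b" "0 < b" using d by auto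
  have ind: "\<zeta> \<in> cball z d \<longleftrightarrow> a \<le> d" "\<zeta> \<in> cball w d \<longleftrightarrow> b \<le> d"
    by (auto simp: a_def b_def dist_norm norm_minus_commute)
  consider "\<zeta> = z" | "a \<noteq> 0" "a \<le> d" | "a \<noteq> 0" "d < a" using a_def by fastforce
  then show ?thesis
  proof cases
    case 1
    then have bd: "b = d" by (simp add: b_def d_def)
    then have "\<zeta> \<in> cball w d" using ind by simp
    moreover have "cmod (1 / (\<zeta> - z) - 1 / (\<zeta> - w)) = 1 / b" using 1 by (simp add: b_def norm_divide)
    moreover have "a = 0" using 1 by (simp add: a_def)
    ultimately show ?thesis using d bd by (simp add: field_simps flip: a_def b_def d_def)
  next
    case 2
    then have a0: "0 < a" by (simp add: a_def)
    have ne: "\<zeta> \<noteq> z" "\<zeta> \<noteq> w" using a0 b by (auto simp: a_def b_def)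
    have "1 / (\<zeta> - z) - 1 / (\<zeta> - w) = (z - w) / ((\<zeta> - z) * (\<zeta> - w))" using ne by (simp add: field_simps)
    then have "cmod (1 / (\<zeta> - z) - 1 / (\<zeta> - w)) = d / (a * b)"
      by (simp add: a_def b_def d_def norm_divide norm_mult)
    also have "\<dots> \<le> 2 * (1 / a)" using a0 b by (simp add: field_simps)
    finally have "cmod (1 / (\<zeta> - z) - 1 / (\<zeta> - w)) \<le> 2 * (1 / a)" .
    moreover have "0 \<le> 2 * (1 / b * indicator (cball w d) \<zeta>)" using b by simp
    moreover have "\<zeta> \<in> cball z d" using ind 2 by simp
    ultimately show ?thesis by (simp flip: a_def b_def d_def)
  next
    case 3
    then have a0: "0 < a" by (simp add: a_def)
    have ne: "\<zeta> \<noteq> z" "\<zeta> \<noteq> w" using a0 b by (auto simp: a_def b_def)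
    have "1 / (\<zeta> - z) - 1 / (\<zeta> - w) = (z - w) / ((\<zeta> - z) * (\<zeta> - w))" using ne by (simp add: field_simps)
    then have "cmod (1 / (\<zeta> - z) - 1 / (\<zeta> - w)) = d / (a * b)"
      by (simp add: a_def b_def d_def norm_divide norm_mult)
    also have "\<dots> \<le> d / a\<^sup>2" unfolding power2_eq_square
      using a0 b d by (intro divide_left_mono mult_left_mono) auto
    finally have "cmod (1 / (\<zeta> - z) - 1 / (\<zeta> - w)) \<le> d / a\<^sup>2" .
    moreover have "0 \<le> 2 * (1 / b * indicator (cball w d) \<zeta>)" using b by simp
    moreover have "\<zeta> \<notin> cball z d" using ind 3 by simp
    ultimately show ?thesis by (simp flip: a_def b_def d_def)
  qed
qed

lemma norm_integral_le_AE:
  fixes f :: "'a \<Rightarrow> 'b :: {banach, second_countable_topology}"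
  assumes "integrable M g" "AE x in M. norm (f x) \<le> g x"
  shows "norm (LINT x|M. f x) \<le> (LINT x|M. g x)"
proof -
  have "norm (LINT x|M. f x) \<le> (LINT x|M. norm (f x))" by (rule integral_norm_bound)
  also have "\<dots> \<le> (LINT x|M. g x)"
  proof (rule integral_mono_AE'[OF assms])
    show "AE x in M. 0 \<le> g x" using assms(2) by eventually_elim (metis norm_ge_zero order_trans)
  qed
  finally show ?thesis .
qed

text \<open>The candidate derivative at \<open>w\<close> is the integral against
  \<open>1 / (\<zeta> - w)\<^sup>2\<close>. An exact identity for the second-order remainder of the
  kernel, bounded because \<open>K\<close> keeps a distance \<open>e\<close> from \<open>w\<close>,
  shows that the error is quadratic in \<open>z - w\<close>.\<close>

lemma analytic_cauchy_transform:
  fixes \<nu> :: "complex measure"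
  assumes "finite_measure \<nu>" and [measurable_cong]: "sets \<nu> = sets borel"
    and [measurable]: "\<phi> \<in> borel_measurable borel"
    and \<phi>: "AE \<zeta> in \<nu>. cmod (\<phi> \<zeta>) \<le> D" and K: "AE \<zeta> in \<nu>. \<zeta> \<in> K"
    and "open U" "U \<inter> K = {}"
  shows "cauchy_transform \<nu> \<phi> analytic_on U"
proof -
  interpret finite_measure \<nu> by fact
  have "\<exists>f'. (cauchy_transform \<nu> \<phi> has_field_derivative f') (at w)" if "w \<in> U" for w
  proof -
    obtain e where e: "0 < e" "ball w e \<subseteq> U" by (rule openE[OF \<open>open U\<close> \<open>w \<in> U\<close>])
    have far: "e \<le> cmod (\<zeta> - w)" if "\<zeta> \<in> K" for \<zeta>
    proof (rule ccontr)
      assume "\<not> e \<le> cmod (\<zeta> - w)"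
      then have "\<zeta> \<in> ball w e" by (simp add: dist_norm norm_minus_commute)
      then show False using e(2) that \<open>U \<inter> K = {}\<close> by blast
    qed
    have int: "integrable \<nu> (\<lambda>\<zeta>. \<phi> \<zeta> * k \<zeta>)"
      if [measurable]: "k \<in> borel_measurable borel" and k: "\<And>\<zeta>. \<zeta> \<in> K \<Longrightarrow> cmod (k \<zeta>) \<le> B" for k B
    \<comment> \<open>The sign of \<open>D\<close> is not known, for instance when
      \<open>\<nu>\<close> vanishes; \<open>max 0\<close> keeps the products monotone.\<close>
    proof (rule integrable_const_bound[where B = "max 0 D * max 0 B"])
      show "AE \<zeta> in \<nu>. cmod (\<phi> \<zeta> * k \<zeta>) \<le> max 0 D * max 0 B"
        using \<phi> K
      proof eventually_elim
        case (elim \<zeta>)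
        then show ?case unfolding norm_mult using k[of \<zeta>] by (intro mult_mono) auto
      qed
    qed measurable
    define f' where "f' = (LINT \<zeta>|\<nu>. \<phi> \<zeta> * (1 / (\<zeta> - w)\<^sup>2))"
    have i2: "integrable \<nu> (\<lambda>\<zeta>. \<phi> \<zeta> * (1 / (\<zeta> - w)\<^sup>2))"
    proof (rule int[where B = "1 / e\<^sup>2"])
      show "cmod (1 / (\<zeta> - w)\<^sup>2) \<le> 1 / e\<^sup>2" if "\<zeta> \<in> K" for \<zeta>
        using far[OF that] e by (auto simp: norm_divide norm_power intro!: divide_left_mono power_mono mult_pos_pos zero_less_power)
    qed measurable
    have i1: "integrable \<nu> (\<lambda>\<zeta>. \<phi> \<zeta> * (1 / (\<zeta> - z)))" if z: "cmod (z - w) \<le> e / 2" for z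
    proof (rule int[where B = "2 / e"])
      show "cmod (1 / (\<zeta> - z)) \<le> 2 / e" if "\<zeta> \<in> K" for \<zeta>
      proof -
        have "e / 2 \<le> cmod (\<zeta> - z)"
          using far[OF that] z norm_triangle_ineq[of "\<zeta> - z" "z - w"] by simp
        then have "1 / cmod (\<zeta> - z) \<le> 1 / (e / 2)" using e by (intro divide_left_mono mult_pos_pos) auto
        then show ?thesis by (simp add: norm_divide)
      qed
    qed measurable
    \<comment> \<open>The remainder kernel has one factor of size at least \<open>e / 2\<close> and
      two of size at least \<open>e\<close> in its denominator.\<close>
    define B where "B = max 0 D * (2 / e ^ 3) * measure \<nu> (space \<nu>)"
    have est: "cmod (cauchy_transform \<nu> \<phi> z - cauchy_transform \<nu> \<phi> w - (z - w) * f') \<le> B * (cmod (z - w))\<^sup>2"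
      if z: "cmod (z - w) \<le> e / 2" for z
    proof -
      have "cauchy_transform \<nu> \<phi> z - cauchy_transform \<nu> \<phi> w - (z - w) * f'
        = (LINT \<zeta>|\<nu>. \<phi> \<zeta> * (1 / (\<zeta> - z)) - \<phi> \<zeta> * (1 / (\<zeta> - w)) - (z - w) * (\<phi> \<zeta> * (1 / (\<zeta> - w)\<^sup>2)))"
      proof -
        have ct: "cauchy_transform \<nu> \<phi> z = (LINT \<zeta>|\<nu>. \<phi> \<zeta> * (1 / (\<zeta> - z)))" for z
          by (simp add: cauchy_transform_def)
        have 0: "cmod (w - w) \<le> e / 2" using e by simp
        show ?thesis unfolding ct f'_def
          by (simp only: Bochner_Integration.integral_diff[OF Bochner_Integration.integrable_diff[OF i1[OF z] i1[OF 0]]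
                integrable_mult_right[OF i2]] Bochner_Integration.integral_diff[OF i1[OF z] i1[OF 0]]
                integral_mult_right_zero)
      qed
      also have "cmod \<dots> \<le> (LINT \<zeta>|\<nu>. max 0 D * (2 / e ^ 3) * (cmod (z - w))\<^sup>2)"
      proof (rule norm_integral_le_AE)
        show "AE \<zeta> in \<nu>. cmod (\<phi> \<zeta> * (1 / (\<zeta> - z)) - \<phi> \<zeta> * (1 / (\<zeta> - w)) - (z - w) * (\<phi> \<zeta> * (1 / (\<zeta> - w)\<^sup>2)))
            \<le> max 0 D * (2 / e ^ 3) * (cmod (z - w))\<^sup>2"
          using \<phi> K
        proof eventually_elim
          case (elim \<zeta>)
          have a: "e \<le> cmod (\<zeta> - w)" using far elim by blast
          have b: "e / 2 \<le> cmod (\<zeta> - z)"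
            using a z norm_triangle_ineq[of "\<zeta> - z" "z - w"] by simp
          have ne: "\<zeta> - z \<noteq> 0" "\<zeta> - w \<noteq> 0" using a b e by auto
          have "1 / x - 1 / y - (y - x) * (1 / y\<^sup>2) = (y - x)\<^sup>2 / (x * y\<^sup>2)"
            if "x \<noteq> 0" "y \<noteq> 0" for x y :: complex
            using that by (simp add: divide_simps power2_eq_square) (simp add: algebra_simps)
          from this[OF ne] have "\<phi> \<zeta> * (1 / (\<zeta> - z)) - \<phi> \<zeta> * (1 / (\<zeta> - w)) - (z - w) * (\<phi> \<zeta> * (1 / (\<zeta> - w)\<^sup>2))
              = \<phi> \<zeta> * ((z - w)\<^sup>2 / ((\<zeta> - z) * (\<zeta> - w)\<^sup>2))"
            by (simp add: algebra_simps)
          then have "cmod (\<phi> \<zeta> * (1 / (\<zeta> - z)) - \<phi> \<zeta> * (1 / (\<zeta> - w)) - (z - w) * (\<phi> \<zeta> * (1 / (\<zeta> - w)\<^sup>2)))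
              = cmod (\<phi> \<zeta>) * ((cmod (z - w))\<^sup>2 / (cmod (\<zeta> - z) * (cmod (\<zeta> - w))\<^sup>2))"
            by (simp add: norm_mult norm_divide norm_power)
          also have "\<dots> \<le> max 0 D * ((cmod (z - w))\<^sup>2 / (e / 2 * e\<^sup>2))"
            using elim a b e by (intro mult_mono divide_left_mono power_mono mult_pos_pos) auto
          also have "\<dots> = max 0 D * (2 / e ^ 3) * (cmod (z - w))\<^sup>2" by (simp add: power3_eq_cube power2_eq_square mult_ac)
          finally show ?case .
        qed
      qed simp
      also have "\<dots> = B * (cmod (z - w))\<^sup>2" by (simp add: B_def)
      finally show ?thesis .
    qed
    have B0: "0 \<le> B" using e by (simp add: B_def)
    have "((\<lambda>z. (cauchy_transform \<nu> \<phi> z - cauchy_transform \<nu> \<phi> w) / (z - w) - f') \<longlongrightarrow> 0) (at w)"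
    proof (rule Lim_null_comparison)
      show "\<forall>\<^sub>F z in at w. cmod ((cauchy_transform \<nu> \<phi> z - cauchy_transform \<nu> \<phi> w) / (z - w) - f')
          \<le> B * cmod (z - w)"
        unfolding eventually_at
      proof (intro exI[of _ "e / 2"] conjI ballI impI)
        fix z assume z: "z \<noteq> w \<and> dist z w < e / 2"
        then have "(cauchy_transform \<nu> \<phi> z - cauchy_transform \<nu> \<phi> w) / (z - w) - f'
            = (cauchy_transform \<nu> \<phi> z - cauchy_transform \<nu> \<phi> w - (z - w) * f') / (z - w)"
          by (simp add: field_simps)
        then show "cmod ((cauchy_transform \<nu> \<phi> z - cauchy_transform \<nu> \<phi> w) / (z - w) - f') \<le> B * cmod (z - w)"
          using est[of z] z by (simp add: norm_divide divide_le_eq power2_eq_square dist_norm mult.assoc)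
      qed (use e in auto)
      show "((\<lambda>z. B * cmod (z - w)) \<longlongrightarrow> 0) (at w)" by (rule tendsto_eq_intros refl | simp)+
    qed
    then show ?thesis unfolding has_field_derivative_iff using Lim_null by blast
  qed
  then show ?thesis using \<open>open U\<close> by (simp add: analytic_on_open holomorphic_on_open)
qed

section \<open>Little Lipschitz regularity of Cauchy transforms of measures with small
  growth\<close>

locale small_growth_measure = finite_measure \<nu> for \<nu> :: "complex measure" +
  fixes \<alpha> C :: real
  assumes sets_\<nu> [measurable_cong]: "sets \<nu> = sets borel" and \<alpha>: "0 < \<alpha>" "\<alpha> < 1" and C: "0 \<le> C"
    and growth: "\<And>z r. 0 < r \<Longrightarrow> emeasure \<nu> (cball z r) \<le> ennreal (C * r powr (1 + \<alpha>))"
    and small_growth: "\<And>\<epsilon>. 0 < \<epsilon> \<Longrightarrow> \<exists>\<rho>>0. \<forall>z r. 0 < r \<longrightarrow> r \<le> \<rho> \<longrightarrow>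
       emeasure \<nu> (cball z r) \<le> ennreal (\<epsilon> * r powr (1 + \<alpha>))"
begin

abbreviation "near_const \<equiv> 2 / (1 - 2 powr (- \<alpha>))"
abbreviation "far_const \<equiv> 4 / (1 - 2 powr (- (1 - \<alpha>)))"

lemma near_const_nonneg: "0 \<le> near_const" and far_const_nonneg: "0 \<le> far_const"
  using powr_neg_less_1[of \<alpha>] powr_neg_less_1[of "1 - \<alpha>"] \<alpha> by simp_all

text \<open>Split at distance 1: the near potential bound applies inside, and outside the kernel is
  at most 1, which costs the total mass.\<close>

lemma nn_integral_reciprocal_le:
  "(\<integral>\<^sup>+ \<zeta>. ennreal (1 / cmod (\<zeta> - z)) \<partial>\<nu>) \<le> ennreal (C * near_const + measure \<nu> (space \<nu>))"
proof -
  have "(\<integral>\<^sup>+ \<zeta>. ennreal (1 / cmod (\<zeta> - z)) \<partial>\<nu>)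
    \<le> (\<integral>\<^sup>+ \<zeta>. ennreal (1 / cmod (\<zeta> - z)) * indicator (cball z 1) \<zeta> + 1 \<partial>\<nu>)"
  proof (rule nn_integral_mono)
    fix \<zeta>
    show "ennreal (1 / cmod (\<zeta> - z)) \<le> ennreal (1 / cmod (\<zeta> - z)) * indicator (cball z 1) \<zeta> + 1"
    proof (cases "\<zeta> \<in> cball z 1")
      case False
      then have "1 < cmod (\<zeta> - z)" by (simp add: dist_norm norm_minus_commute)
      then have "1 / cmod (\<zeta> - z) \<le> 1" by (simp add: divide_le_eq_1)
      then show ?thesis using False by (simp add: ennreal_leI flip: ennreal_1)
    qed simp
  qed
  also have "\<dots> = (\<integral>\<^sup>+ \<zeta>. ennreal (1 / cmod (\<zeta> - z)) * indicator (cball z 1) \<zeta> \<partial>\<nu>) + emeasure \<nu> (space \<nu>)"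
  proof -
    have [measurable]: "cball z 1 \<in> sets borel" by simp
    show ?thesis by (subst nn_integral_add) auto
  qed
  also have "\<dots> \<le> ennreal (2 * C / (1 - 2 powr (- \<alpha>)) * 1 powr \<alpha>) + ennreal (measure \<nu> (space \<nu>))"
    using near_potential_bound[OF sets_\<nu> \<alpha>(1) C, of 1 z] growth
    by (intro add_mono) (auto simp: emeasure_eq_measure)
  also have "\<dots> = ennreal (C * near_const + measure \<nu> (space \<nu>))"
    using near_const_nonneg C powr_neg_less_1[OF \<alpha>(1)] by (subst ennreal_plus[symmetric]) (auto simp: mult.commute)
  finally show ?thesis .
qed

lemma integrable_cauchy_kernel:
  assumes [measurable]: "\<phi> \<in> borel_measurable borel" and \<phi>: "AE \<zeta> in \<nu>. cmod (\<phi> \<zeta>) \<le> D" and D: "0 \<le> D"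
  shows "integrable \<nu> (\<lambda>\<zeta>. \<phi> \<zeta> / (\<zeta> - z))"
    and "cmod (cauchy_transform \<nu> \<phi> z) \<le> D * (C * near_const + measure \<nu> (space \<nu>))"
proof -
  have 1: "(\<integral>\<^sup>+ \<zeta>. ennreal (cmod (\<phi> \<zeta> / (\<zeta> - z))) \<partial>\<nu>) \<le> ennreal (D * (C * near_const + measure \<nu> (space \<nu>)))"
  proof -
    have "(\<integral>\<^sup>+ \<zeta>. ennreal (cmod (\<phi> \<zeta> / (\<zeta> - z))) \<partial>\<nu>) \<le> (\<integral>\<^sup>+ \<zeta>. ennreal D * ennreal (1 / cmod (\<zeta> - z)) \<partial>\<nu>)"
    proof (rule nn_integral_mono_AE, use \<phi> in eventually_elim)
      case (elim \<zeta>)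
      then have "cmod (\<phi> \<zeta> / (\<zeta> - z)) \<le> D * (1 / cmod (\<zeta> - z))"
        by (simp add: norm_divide divide_right_mono)
      then show ?case using D by (simp add: ennreal_leI flip: ennreal_mult)
    qed
    also have "\<dots> = ennreal D * (\<integral>\<^sup>+ \<zeta>. ennreal (1 / cmod (\<zeta> - z)) \<partial>\<nu>)"
      by (rule nn_integral_cmult) measurable
    also have "\<dots> \<le> ennreal D * ennreal (C * near_const + measure \<nu> (space \<nu>))"
      by (intro mult_left_mono nn_integral_reciprocal_le) simp
    finally show ?thesis using D C near_const_nonneg by (simp add: ennreal_mult)
  qed
  show int: "integrable \<nu> (\<lambda>\<zeta>. \<phi> \<zeta> / (\<zeta> - z))"
  proof (rule integrableI_bounded)
    show "(\<integral>\<^sup>+ \<zeta>. ennreal (cmod (\<phi> \<zeta> / (\<zeta> - z))) \<partial>\<nu>) < \<infinity>" using 1 by (simp add: le_less_trans)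
  qed measurable
  have "ennreal (cmod (cauchy_transform \<nu> \<phi> z)) \<le> ennreal (D * (C * near_const + measure \<nu> (space \<nu>)))"
    unfolding cauchy_transform_def using integral_norm_bound_ennreal[OF int] 1 by (rule order_trans)
  then show "cmod (cauchy_transform \<nu> \<phi> z) \<le> D * (C * near_const + measure \<nu> (space \<nu>))"
    using D C near_const_nonneg by (simp add: ennreal_le_iff)
qed

text \<open>Three ranges of distance: up to \<open>d = cmod (z - w)\<close> the singular kernels
  themselves, from \<open>d\<close> to \<open>\<rho>\<close> the decay \<open>d\<close> over the
  squared distance, beyond \<open>\<rho>\<close> the crude bound \<open>d / \<rho>\<^sup>2\<close>.
  The first two ranges carry the small factor \<open>\<epsilon>\<close>; the last is linear in
  \<open>d\<close>.\<close>

lemma nn_integral_kernel_diff_le: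
  assumes "z \<noteq> w" "cmod (z - w) \<le> \<rho>" "0 \<le> \<epsilon>"
    and gr: "\<And>z r. 0 < r \<Longrightarrow> r \<le> \<rho> \<Longrightarrow> emeasure \<nu> (cball z r) \<le> ennreal (\<epsilon> * r powr (1 + \<alpha>))"
  shows "(\<integral>\<^sup>+ \<zeta>. ennreal (cmod (1 / (\<zeta> - z) - 1 / (\<zeta> - w))) \<partial>\<nu>)
    \<le> ennreal (2 * (2 * (\<epsilon> * near_const * cmod (z - w) powr \<alpha>)
         + cmod (z - w) * (\<epsilon> * far_const * cmod (z - w) powr (\<alpha> - 1))
         + cmod (z - w) * (measure \<nu> (space \<nu>) / \<rho>\<^sup>2)))"
proof -
  define d where "d = cmod (z - w)"
  have d: "0 < d" "d \<le> \<rho>" using assms by (auto simp: d_def)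
  define N where "N v \<zeta> = ennreal (1 / cmod (\<zeta> - v)) * indicator (cball v d) \<zeta>" for v \<zeta> :: complex
  define F where "F v \<zeta> = ennreal (1 / (cmod (\<zeta> - v))\<^sup>2) * indicator (cball v \<rho> - cball v d) \<zeta>" for v \<zeta> :: complex
  \<comment> \<open>A majorant centred at one point. The sum \<open>T z + T w\<close> is symmetric
    and so works whichever of the two points is nearer to \<open>\<zeta>\<close>.\<close>
  define T where "T v \<zeta> = 2 * N v \<zeta> + ennreal d * (F v \<zeta> + ennreal (1 / \<rho>\<^sup>2))" for v \<zeta> :: complex
  have [measurable]: "cball v r \<in> sets borel" for v :: complex and r by simp
  have [measurable]: "N v \<in> borel_measurable \<nu>" "F v \<in> borel_measurable \<nu>" for v
    unfolding N_def F_def by measurable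
  \<comment> \<open>Here \<open>z\<close> and \<open>w\<close> are quantified afresh, so that the
    bound can also be applied with the two points exchanged.\<close>
  have half: "ennreal (cmod (1 / (\<zeta> - z) - 1 / (\<zeta> - w))) \<le> T z \<zeta> + T w \<zeta>"
    if "z \<noteq> w" "d = cmod (z - w)" "cmod (\<zeta> - z) \<le> cmod (\<zeta> - w)" for z w \<zeta>
  proof -
    have far: "1 / (cmod (\<zeta> - z))\<^sup>2 * indicator (- cball z d) \<zeta> \<le>
        1 / (cmod (\<zeta> - z))\<^sup>2 * indicator (cball z \<rho> - cball z d) \<zeta> + 1 / \<rho>\<^sup>2"
    proof (cases "\<zeta> \<in> cball z \<rho>")
      case True
      then show ?thesis by (auto simp: indicator_def)
    next
      case False
      then have "\<rho> < cmod (\<zeta> - z)" by (simp add: dist_norm norm_minus_commute)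
      then have "1 / (cmod (\<zeta> - z))\<^sup>2 \<le> 1 / \<rho>\<^sup>2" using d by (intro divide_left_mono power_mono mult_pos_pos zero_less_power) auto
      then show ?thesis using False d by (auto simp: indicator_def)
    qed
    have NF: "N v \<zeta> = ennreal (1 / cmod (\<zeta> - v) * indicator (cball v d) \<zeta>)"
      "F v \<zeta> = ennreal (1 / (cmod (\<zeta> - v))\<^sup>2 * indicator (cball v \<rho> - cball v d) \<zeta>)" for v
      by (simp_all add: N_def F_def indicator_def)
    have sum_eq: "2 * ennreal x + ennreal d * (ennreal y + ennreal q) + 2 * ennreal u
        = ennreal (2 * x + d * (y + q) + 2 * u)" if "0 \<le> x" "0 \<le> y" "0 \<le> q" "0 \<le> u" for x y q u
      using that d by (simp add: ennreal_plus ennreal_mult)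
    have "cmod (1 / (\<zeta> - z) - 1 / (\<zeta> - w)) \<le>
      2 * (1 / cmod (\<zeta> - z) * indicator (cball z d) \<zeta>)
        + d * (1 / (cmod (\<zeta> - z))\<^sup>2 * indicator (- cball z d) \<zeta>)
        + 2 * (1 / cmod (\<zeta> - w) * indicator (cball w d) \<zeta>)"
      using norm_diff_reciprocals_le[OF that(1,3)] that(2) by simp
    also have "\<dots> \<le> 2 * (1 / cmod (\<zeta> - z) * indicator (cball z d) \<zeta>)
        + d * (1 / (cmod (\<zeta> - z))\<^sup>2 * indicator (cball z \<rho> - cball z d) \<zeta> + 1 / \<rho>\<^sup>2)
        + 2 * (1 / cmod (\<zeta> - w) * indicator (cball w d) \<zeta>)"
      using far d by (intro add_mono mult_left_mono) auto
    finally have "ennreal (cmod (1 / (\<zeta> - z) - 1 / (\<zeta> - w)))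
      \<le> ennreal (2 * (1 / cmod (\<zeta> - z) * indicator (cball z d) \<zeta>)
        + d * (1 / (cmod (\<zeta> - z))\<^sup>2 * indicator (cball z \<rho> - cball z d) \<zeta> + 1 / \<rho>\<^sup>2)
        + 2 * (1 / cmod (\<zeta> - w) * indicator (cball w d) \<zeta>))" by (rule ennreal_leI)
    also have "\<dots> = T z \<zeta> + 2 * N w \<zeta>"
      unfolding T_def NF by (rule sum_eq[symmetric]) auto
    also have "\<dots> \<le> T z \<zeta> + T w \<zeta>" unfolding T_def by (intro add_left_mono) simp
    finally show ?thesis .
  qed
  have "ennreal (cmod (1 / (\<zeta> - z) - 1 / (\<zeta> - w))) \<le> T z \<zeta> + T w \<zeta>" for \<zeta>
  proof (cases "cmod (\<zeta> - z) \<le> cmod (\<zeta> - w)")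
    case True
    then show ?thesis using half assms(1) d_def by blast
  next
    case False
    then show ?thesis using half[of w z \<zeta>] assms(1)
      by (simp add: d_def norm_minus_commute add.commute)
  qed
  then have "(\<integral>\<^sup>+ \<zeta>. ennreal (cmod (1 / (\<zeta> - z) - 1 / (\<zeta> - w))) \<partial>\<nu>) \<le> (\<integral>\<^sup>+ \<zeta>. T z \<zeta> + T w \<zeta> \<partial>\<nu>)"
    by (intro nn_integral_mono) auto
  also have "\<dots> = (\<integral>\<^sup>+ \<zeta>. T z \<zeta> \<partial>\<nu>) + (\<integral>\<^sup>+ \<zeta>. T w \<zeta> \<partial>\<nu>)"
    unfolding T_def by (intro nn_integral_add) measurable
  also have "\<dots> \<le> ennreal (2 * (\<epsilon> * near_const * d powr \<alpha>)
         + d * (\<epsilon> * far_const * d powr (\<alpha> - 1)) + d * (measure \<nu> (space \<nu>) / \<rho>\<^sup>2))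
      + ennreal (2 * (\<epsilon> * near_const * d powr \<alpha>)
         + d * (\<epsilon> * far_const * d powr (\<alpha> - 1)) + d * (measure \<nu> (space \<nu>) / \<rho>\<^sup>2))"
  proof (rule add_mono)
    show "(\<integral>\<^sup>+ \<zeta>. T v \<zeta> \<partial>\<nu>) \<le> ennreal (2 * (\<epsilon> * near_const * d powr \<alpha>)
         + d * (\<epsilon> * far_const * d powr (\<alpha> - 1)) + d * (measure \<nu> (space \<nu>) / \<rho>\<^sup>2))" for v
    proof -
      have "(\<integral>\<^sup>+ \<zeta>. T v \<zeta> \<partial>\<nu>) = 2 * (\<integral>\<^sup>+ \<zeta>. N v \<zeta> \<partial>\<nu>)
          + ennreal d * ((\<integral>\<^sup>+ \<zeta>. F v \<zeta> \<partial>\<nu>) + ennreal (1 / \<rho>\<^sup>2) * emeasure \<nu> (space \<nu>))"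
        unfolding T_def by (simp add: nn_integral_add nn_integral_cmult)
      also have "\<dots> \<le> ennreal 2 * ennreal (\<epsilon> * near_const * d powr \<alpha>)
          + ennreal d * (ennreal (\<epsilon> * far_const * d powr (\<alpha> - 1)) + ennreal (1 / \<rho>\<^sup>2) * ennreal (measure \<nu> (space \<nu>)))"
      proof (intro add_mono mult_mono)
        show "(\<integral>\<^sup>+ \<zeta>. N v \<zeta> \<partial>\<nu>) \<le> ennreal (\<epsilon> * near_const * d powr \<alpha>)"
          unfolding N_def using near_potential_bound[OF sets_\<nu> \<alpha>(1) assms(3) d(1), of v] gr d
          by (simp add: mult.commute)
        show "(\<integral>\<^sup>+ \<zeta>. F v \<zeta> \<partial>\<nu>) \<le> ennreal (\<epsilon> * far_const * d powr (\<alpha> - 1))"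
          unfolding F_def using far_potential_bound[OF sets_\<nu> \<alpha> assms(3) d(1), of \<rho> v] gr d
          by (simp add: mult.commute)
      qed (auto simp: emeasure_eq_measure)
      also have "\<dots> = ennreal (2 * (\<epsilon> * near_const * d powr \<alpha>)
         + d * (\<epsilon> * far_const * d powr (\<alpha> - 1)) + d * (measure \<nu> (space \<nu>) / \<rho>\<^sup>2))"
      proof -
        have nn: "0 \<le> \<epsilon> * near_const * d powr \<alpha>" "0 \<le> \<epsilon> * far_const * d powr (\<alpha> - 1)"
          using near_const_nonneg far_const_nonneg assms(3) by simp_all
        have sum_eq: "ennreal 2 * ennreal x + ennreal y * (ennreal z + ennreal q * ennreal V)
            = ennreal (2 * x + y * z + y * (q * V))"
          if "0 \<le> x" "0 \<le> y" "0 \<le> z" "0 \<le> V" "0 \<le> q" for x y z q V :: real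
          using that by (simp add: ennreal_plus ennreal_mult distrib_left add.assoc)
        have q: "measure \<nu> (space \<nu>) / \<rho>\<^sup>2 = 1 / \<rho>\<^sup>2 * measure \<nu> (space \<nu>)" by simp
        show ?thesis unfolding q by (rule sum_eq[OF nn(1) _ nn(2)]) (use d in auto)
      qed
      finally show ?thesis .
    qed
    then show "(\<integral>\<^sup>+ \<zeta>. T w \<zeta> \<partial>\<nu>) \<le> ennreal (2 * (\<epsilon> * near_const * d powr \<alpha>)
         + d * (\<epsilon> * far_const * d powr (\<alpha> - 1)) + d * (measure \<nu> (space \<nu>) / \<rho>\<^sup>2))" .
  qed
  also have "\<dots> = ennreal (2 * (2 * (\<epsilon> * near_const * d powr \<alpha>)
         + d * (\<epsilon> * far_const * d powr (\<alpha> - 1)) + d * (measure \<nu> (space \<nu>) / \<rho>\<^sup>2)))"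
    using near_const_nonneg far_const_nonneg assms(3) d by (subst ennreal_plus[symmetric]) auto
  finally show ?thesis by (simp only: d_def)
qed

text \<open>Small growth makes the main terms an arbitrarily small multiple of
  \<open>cmod (z - w) powr \<alpha>\<close>, and the remaining term is linear, hence of lower order
  because \<open>\<alpha> < 1\<close>.\<close>

lemma cauchy_transform_in_lip:
  assumes [measurable]: "\<phi> \<in> borel_measurable borel" and \<phi>: "AE \<zeta> in \<nu>. cmod (\<phi> \<zeta>) \<le> D" and D: "0 \<le> D"
  shows "cauchy_transform \<nu> \<phi> \<in> lip \<alpha>"
proof -
  let ?f = "cauchy_transform \<nu> \<phi>"
  define V where "V = measure \<nu> (space \<nu>)"
  define B where "B = D * (C * near_const + V)"
  have bound: "cmod (?f z) \<le> B" for z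
    using integrable_cauchy_kernel(2)[OF assms] by (simp add: B_def V_def)
  have little: "\<exists>\<delta>>0. \<forall>z w. cmod (z - w) < \<delta> \<longrightarrow> cmod (?f z - ?f w) \<le> e * cmod (z - w) powr \<alpha>"
    if "0 < e" for e
  proof -
    \<comment> \<open>The coefficient of \<open>\<epsilon> * d powr \<alpha>\<close> in the final
      estimate; \<open>\<epsilon>\<close> is chosen below so that \<open>A * \<epsilon>\<close> is
      at most \<open>e / 2\<close>, with \<open>A + 1\<close> avoiding a division by zero.\<close>
    define A where "A = 2 * D * (2 * near_const + far_const)"
    have A0: "0 \<le> A" using D near_const_nonneg far_const_nonneg by (simp add: A_def)
    define \<epsilon> where "\<epsilon> = e / (2 * (A + 1))"
    have \<epsilon>: "0 < \<epsilon>" using that A0 by (simp add: \<epsilon>_def)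
    obtain \<rho> where \<rho>: "0 < \<rho>" and gr: "\<And>z r. 0 < r \<Longrightarrow> r \<le> \<rho> \<Longrightarrow> emeasure \<nu> (cball z r) \<le> ennreal (\<epsilon> * r powr (1 + \<alpha>))"
      using small_growth[OF \<epsilon>] by blast
    \<comment> \<open>The linear term is written as
      \<open>d powr (1 - \<alpha>) * d powr \<alpha>\<close>; its first factor tends to 0 and takes
      the other half of \<open>e\<close>.\<close>
    have "((\<lambda>d. 2 * D * V / \<rho>\<^sup>2 * d powr (1 - \<alpha>)) \<longlongrightarrow> 2 * D * V / \<rho>\<^sup>2 * 0) (at_right 0)"
      using \<alpha> by (intro tendsto_mult tendsto_const tendsto_zero_powrI[OF tendsto_ident_at tendsto_const])
        (auto simp: eventually_at_right_field intro!: exI[of _ 1])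
    then have "\<forall>\<^sub>F d in at_right 0. 2 * D * V / \<rho>\<^sup>2 * d powr (1 - \<alpha>) < e / 2"
      using that by (intro order_tendstoD(2)) auto
    then obtain \<delta>1 where \<delta>1: "0 < \<delta>1" "\<And>d. 0 < d \<Longrightarrow> d < \<delta>1 \<Longrightarrow> 2 * D * V / \<rho>\<^sup>2 * d powr (1 - \<alpha>) < e / 2"
      unfolding eventually_at_right_field by auto
    show ?thesis
    proof (intro exI[of _ "min \<delta>1 \<rho>"] conjI allI impI)
      fix z w assume zw: "cmod (z - w) < min \<delta>1 \<rho>"
      show "cmod (?f z - ?f w) \<le> e * cmod (z - w) powr \<alpha>"
      proof (cases "z = w")
        case False
        define d where "d = cmod (z - w)"
        have d: "0 < d" "d < \<delta>1" "d \<le> \<rho>" using zw False by (auto simp: d_def)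
        define I where "I = 2 * (2 * (\<epsilon> * near_const * d powr \<alpha>) + d * (\<epsilon> * far_const * d powr (\<alpha> - 1)) + d * (V / \<rho>\<^sup>2))"
        have I0: "0 \<le> I" unfolding I_def
          using \<epsilon> near_const_nonneg far_const_nonneg d by (auto simp: V_def)
        have int: "integrable \<nu> (\<lambda>\<zeta>. \<phi> \<zeta> / (\<zeta> - z) - \<phi> \<zeta> / (\<zeta> - w))"
          using integrable_cauchy_kernel(1)[OF assms] by (intro Bochner_Integration.integrable_diff)
        have "?f z - ?f w = (LINT \<zeta>|\<nu>. \<phi> \<zeta> / (\<zeta> - z) - \<phi> \<zeta> / (\<zeta> - w))"
          unfolding cauchy_transform_def using integrable_cauchy_kernel(1)[OF assms]
          by (intro Bochner_Integration.integral_diff[symmetric])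
        then have "ennreal (cmod (?f z - ?f w)) \<le> (\<integral>\<^sup>+ \<zeta>. ennreal (cmod (\<phi> \<zeta> / (\<zeta> - z) - \<phi> \<zeta> / (\<zeta> - w))) \<partial>\<nu>)"
          using integral_norm_bound_ennreal[OF int] by simp
        also have "\<dots> \<le> (\<integral>\<^sup>+ \<zeta>. ennreal D * ennreal (cmod (1 / (\<zeta> - z) - 1 / (\<zeta> - w))) \<partial>\<nu>)"
        proof (rule nn_integral_mono_AE, use \<phi> in eventually_elim)
          case (elim \<zeta>)
          have "\<phi> \<zeta> / (\<zeta> - z) - \<phi> \<zeta> / (\<zeta> - w) = \<phi> \<zeta> * (1 / (\<zeta> - z) - 1 / (\<zeta> - w))"
            by (simp add: right_diff_distrib)
          then have "cmod (\<phi> \<zeta> / (\<zeta> - z) - \<phi> \<zeta> / (\<zeta> - w)) \<le> D * cmod (1 / (\<zeta> - z) - 1 / (\<zeta> - w))"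
            using elim by (simp add: norm_mult mult_right_mono)
          then show ?case using D by (simp add: ennreal_leI flip: ennreal_mult)
        qed
        also have "\<dots> = ennreal D * (\<integral>\<^sup>+ \<zeta>. ennreal (cmod (1 / (\<zeta> - z) - 1 / (\<zeta> - w))) \<partial>\<nu>)"
          by (rule nn_integral_cmult) measurable
        also have "\<dots> \<le> ennreal D * ennreal I"
          using nn_integral_kernel_diff_le[OF False, of \<rho> \<epsilon>] gr d \<epsilon>
          by (intro mult_left_mono) (auto simp: I_def d_def V_def)
        finally have "cmod (?f z - ?f w) \<le> D * I" using D I0 by (simp flip: ennreal_mult)
        also have "D * I = A * \<epsilon> * d powr \<alpha> + (2 * D * V / \<rho>\<^sup>2 * d powr (1 - \<alpha>)) * d powr \<alpha>"
        proof -
          have 1: "d * (\<epsilon> * far_const * d powr (\<alpha> - 1)) = \<epsilon> * far_const * d powr \<alpha>"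
            using d by (simp add: powr_diff)
          have 2: "d powr (1 - \<alpha>) * d powr \<alpha> = d" using d by (simp flip: powr_add)
          have "(2 * D * V / \<rho>\<^sup>2 * d powr (1 - \<alpha>)) * d powr \<alpha> = 2 * D * V / \<rho>\<^sup>2 * d"
            by (simp only: mult.assoc 2)
          moreover have "D * I = A * \<epsilon> * d powr \<alpha> + 2 * D * V / \<rho>\<^sup>2 * d"
            unfolding I_def 1 by (simp add: A_def algebra_simps)
          ultimately show ?thesis by (simp only:)
        qed
        also have "\<dots> \<le> e / 2 * d powr \<alpha> + e / 2 * d powr \<alpha>"
        proof (intro add_mono mult_right_mono)
          show "A * \<epsilon> \<le> e / 2" using that A0 by (simp add: \<epsilon>_def field_simps)
          show "2 * D * V / \<rho>\<^sup>2 * d powr (1 - \<alpha>) \<le> e / 2" using \<delta>1(2)[OF d(1,2)] by simp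
        qed auto
        finally show ?thesis by (simp add: d_def)
      qed simp
    qed (use \<delta>1 \<rho> in auto)
  qed
  \<comment> \<open>A global constant: the local estimate with \<open>e = 1\<close> at small
    distances, and boundedness of the transform at distances of at least
    \<open>\<delta>\<close>.\<close>
  obtain \<delta> where \<delta>: "0 < \<delta>" "\<And>z w. cmod (z - w) < \<delta> \<Longrightarrow> cmod (?f z - ?f w) \<le> 1 * cmod (z - w) powr \<alpha>"
    using little[of 1] by auto
  have B0: "0 \<le> B" using bound[of 0] norm_ge_zero order_trans by blast
  have "cmod (?f z - ?f w) \<le> (1 + 2 * B / \<delta> powr \<alpha>) * cmod (z - w) powr \<alpha>" for z w
  proof (cases "cmod (z - w) < \<delta>")
    case True
    have "cmod (?f z - ?f w) \<le> 1 * cmod (z - w) powr \<alpha>" by (rule \<delta>(2)[OF True])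
    also have "\<dots> \<le> (1 + 2 * B / \<delta> powr \<alpha>) * cmod (z - w) powr \<alpha>"
      using B0 by (intro mult_right_mono) auto
    finally show ?thesis .
  next
    case False
    have "cmod (?f z - ?f w) \<le> 2 * B" using norm_triangle_ineq4[of "?f z" "?f w"] bound[of z] bound[of w] by simp
    also have "\<dots> = 2 * B / \<delta> powr \<alpha> * \<delta> powr \<alpha>" using \<delta> by simp
    also have "\<dots> \<le> (1 + 2 * B / \<delta> powr \<alpha>) * cmod (z - w) powr \<alpha>"
      using False \<delta>(1) B0 \<alpha> by (intro mult_mono powr_mono2) auto
    finally show ?thesis .
  qed
  moreover have "0 < 1 + 2 * B / \<delta> powr \<alpha>" using B0 by (intro add_pos_nonneg) auto
  ultimately have "?f \<in> Lip \<alpha>"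
    unfolding Lip_def using bound by (auto simp: bounded_iff)
  then show ?thesis using little by (simp add: lip_def)
qed

end

section \<open>Test functions supported off one annulus\<close>

text \<open>To be used with \<open>a = \<zeta> - x0\<close> and \<open>b = z - x0\<close>, so that
  \<open>a - b = \<zeta> - z\<close>. The inductive step divides by \<open>b\<close> and splits the
  leading term once more.\<close>

lemma partial_fractions:
  fixes a b :: complex
  assumes "a \<noteq> 0" "b \<noteq> 0" "a \<noteq> b"
  shows "1 / ((a - b) * b ^ t) = 1 / (a ^ t * (a - b)) + (\<Sum>j<t. 1 / (a ^ (t - j) * b ^ Suc j))"
proof (induction t)
  case 0
  then show ?case by simp
next
  case (Suc t)
  have "1 / ((a - b) * b ^ Suc t) = 1 / b * (1 / ((a - b) * b ^ t))" by simp
  also have "\<dots> = 1 / (b * (a ^ t * (a - b))) + (\<Sum>j<t. 1 / (a ^ (t - j) * b ^ Suc (Suc j)))"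
    unfolding Suc by (simp add: distrib_left sum_distrib_left mult_ac)
  also have "1 / (b * (a ^ t * (a - b))) = 1 / (a ^ Suc t * (a - b)) + 1 / (a ^ Suc t * b)"
  proof -
    have "1 / (b * (c * d)) = 1 / (a * c * d) + 1 / (a * c * b)" if "d = a - b" "c \<noteq> 0" "d \<noteq> 0" for c d
      using assms that by (simp add: field_simps)
    from this[of "a - b" "a ^ t"] show ?thesis using assms by simp
  qed
  finally show ?case by (subst sum.lessThan_Suc_shift) (simp add: add.assoc)
qed

section \<open>Cauchy transforms and the powers of \<open>z - x0\<close>\<close>

context small_growth_measure
begin

text \<open>Growth as \<open>r\<close> tends to 0 rules out atoms. This matters because partial
  fractions fail at \<open>\<zeta> = z\<close>, where the kernel has the default value 0.\<close>

lemma AE_neq: "AE \<zeta> in \<nu>. \<zeta> \<noteq> z"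
proof -
  have "emeasure \<nu> {z} = 0"
  proof (rule ccontr)
    assume ne: "emeasure \<nu> {z} \<noteq> 0"
    then have pos: "0 < measure \<nu> {z}" by (simp add: emeasure_eq_measure zero_less_measure_iff)
    have le: "measure \<nu> {z} \<le> C * r powr (1 + \<alpha>)" if "0 < r" for r
    proof -
      have "emeasure \<nu> {z} \<le> emeasure \<nu> (cball z r)" using that sets_\<nu> by (intro emeasure_mono) auto
      also have "\<dots> \<le> ennreal (C * r powr (1 + \<alpha>))" by (rule growth[OF that])
      finally show ?thesis using C by (simp add: emeasure_eq_measure)
    qed
    have "((\<lambda>r. C * r powr (1 + \<alpha>)) \<longlongrightarrow> C * 0) (at_right 0)"
      using \<alpha> by (intro tendsto_mult tendsto_const tendsto_zero_powrI[OF tendsto_ident_at tendsto_const])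
        (auto simp: eventually_at_right_field intro!: exI[of _ 1])
    moreover have "\<forall>\<^sub>F r in at_right 0. measure \<nu> {z} \<le> C * r powr (1 + \<alpha>)"
      using le by (auto simp: eventually_at_right_field intro!: exI[of _ 1])
    ultimately have "measure \<nu> {z} \<le> C * 0"
      by (intro tendsto_lowerbound) auto
    then show False using pos by simp
  qed
  then show ?thesis by (intro AE_I[of _ _ "{z}"]) (auto simp: sets_\<nu>)
qed

text \<open>Near \<open>x0\<close> the uniform bound is used. Once
  \<open>2 * R \<le> cmod (z - x0)\<close> the kernel is at most \<open>2 / cmod (z - x0)\<close> on
  the support, and the total mass is at most \<open>C * R\<close>.\<close>

lemma cauchy_transform_decay:
  assumes [measurable]: "\<phi> \<in> borel_measurable borel" and \<phi>: "AE \<zeta> in \<nu>. cmod (\<phi> \<zeta>) \<le> 1"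
    and R: "0 < R" "R \<le> 1" and supp: "AE \<zeta> in \<nu>. cmod (\<zeta> - x0) \<le> R" and "z \<noteq> x0"
  shows "cmod (cauchy_transform \<nu> \<phi> z) \<le> 2 * C * (near_const + 1) * min 1 (R / cmod (z - x0))"
proof -
  define V where "V = measure \<nu> (space \<nu>)"
  define \<rho> where "\<rho> = cmod (z - x0)"
  have \<rho>: "0 < \<rho>" using \<open>z \<noteq> x0\<close> by (simp add: \<rho>_def)
  have V: "V \<le> C * R"
  proof -
    have "emeasure \<nu> (space \<nu>) \<le> emeasure \<nu> (cball x0 R)"
      using supp by (intro emeasure_mono_AE) (auto simp: sets_\<nu> dist_norm norm_minus_commute elim: eventually_mono)
    also have "\<dots> \<le> ennreal (C * R powr (1 + \<alpha>))" by (rule growth[OF R(1)])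
    finally have "V \<le> C * R powr (1 + \<alpha>)" using C by (simp add: emeasure_eq_measure V_def)
    \<comment> \<open>As \<open>R \<le> 1\<close>, lowering the exponent enlarges the power; only
      the linear order in \<open>R\<close> is kept.\<close>
    also have "\<dots> \<le> C * R powr 1" using C R \<alpha> by (intro mult_left_mono powr_mono') auto
    finally show ?thesis using R by simp
  qed
  have B0: "0 \<le> C * (near_const + 1)" using C near_const_nonneg by simp
  have "cmod (cauchy_transform \<nu> \<phi> z) \<le> C * near_const + V"
    using integrable_cauchy_kernel(2)[OF assms(1,2)] by (simp add: V_def)
  also have "\<dots> \<le> C * near_const + C * 1"
    using V C R by (intro add_left_mono order_trans[OF V] mult_left_mono) auto
  finally have unif: "cmod (cauchy_transform \<nu> \<phi> z) \<le> C * (near_const + 1)" by (simp add: distrib_left)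
  have "cmod (cauchy_transform \<nu> \<phi> z) \<le> 2 * (C * (near_const + 1)) * (R / \<rho>)"
  proof (cases "2 * R \<le> \<rho>")
    case True
    have "cmod (cauchy_transform \<nu> \<phi> z) \<le> (LINT \<zeta>|\<nu>. 2 / \<rho>)"
      unfolding cauchy_transform_def
    proof (rule norm_integral_le_AE)
      show "AE \<zeta> in \<nu>. cmod (\<phi> \<zeta> / (\<zeta> - z)) \<le> 2 / \<rho>"
        using \<phi> supp
      proof eventually_elim
        case (elim \<zeta>)
        have "\<rho> / 2 \<le> cmod (\<zeta> - z)"
          using elim(2) True norm_triangle_ineq4[of "\<zeta> - x0" "\<zeta> - z"] by (simp add: \<rho>_def)
        then have "cmod (\<phi> \<zeta>) / cmod (\<zeta> - z) \<le> 1 / (\<rho> / 2)" using elim(1) \<rho> by (intro frac_le) auto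
        then show ?case by (simp add: norm_divide)
      qed
    qed simp
    also have "\<dots> = 2 * V / \<rho>" by (simp add: V_def)
    also have "\<dots> \<le> 2 * (C * R) / \<rho>" using V \<rho> by (intro divide_right_mono) auto
    also have "\<dots> = 2 * C * 1 * (R / \<rho>)" by simp
    also have "\<dots> \<le> 2 * C * (near_const + 1) * (R / \<rho>)"
      using C R \<rho> near_const_nonneg by (intro mult_right_mono mult_left_mono) auto
    finally show ?thesis by (simp only: mult.assoc)
  next
    case False
    then have "1 \<le> 2 * (R / \<rho>)" using \<rho> by (simp add: field_simps)
    then have "C * (near_const + 1) * 1 \<le> C * (near_const + 1) * (2 * (R / \<rho>))"
      using B0 by (rule mult_left_mono)
    then have "C * (near_const + 1) \<le> 2 * (C * (near_const + 1)) * (R / \<rho>)"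
      by (simp only: mult_1_right mult_ac)
    with unif show ?thesis by (rule order_trans)
  qed
  moreover have "cmod (cauchy_transform \<nu> \<phi> z) \<le> 2 * (C * (near_const + 1)) * 1"
    using unif B0 by linarith
  ultimately show ?thesis using B0 by (simp add: min_def \<rho>_def mult.assoc)
qed

text \<open>The partial fraction identity integrated over \<open>\<zeta>\<close>. The coefficients
  of the negative powers of \<open>z - x0\<close> are integrals that do not depend on
  \<open>z\<close>.\<close>

lemma cauchy_transform_divide_power:
  assumes [measurable]: "\<theta> \<in> borel_measurable borel" and \<theta>: "AE \<zeta> in \<nu>. cmod (\<theta> \<zeta>) \<le> 1"
    and "0 < R" and away: "AE \<zeta> in \<nu>. R \<le> cmod (\<zeta> - x0)" and "z \<noteq> x0"
  shows "cauchy_transform \<nu> \<theta> z / (z - x0) ^ t =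
    cauchy_transform \<nu> (\<lambda>\<zeta>. \<theta> \<zeta> / (\<zeta> - x0) ^ t) z
      + (\<Sum>j<t. (LINT \<zeta>|\<nu>. \<theta> \<zeta> / (\<zeta> - x0) ^ (t - j)) / (z - x0) ^ Suc j)"
proof -
  have bnd: "AE \<zeta> in \<nu>. cmod (\<theta> \<zeta> / (\<zeta> - x0) ^ i) \<le> (1 / R) ^ i" for i
    using \<theta> away
  proof eventually_elim
    case (elim \<zeta>)
    then have "cmod (\<theta> \<zeta>) / cmod (\<zeta> - x0) ^ i \<le> 1 / R ^ i"
      using \<open>0 < R\<close> by (intro frac_le power_mono) auto
    then show ?case by (simp add: norm_divide norm_power power_one_over)
  qed
  have int: "integrable \<nu> (\<lambda>\<zeta>. \<theta> \<zeta> / (\<zeta> - x0) ^ i)" for i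
    by (rule integrable_const_bound[OF bnd]) measurable
  have intk: "integrable \<nu> (\<lambda>\<zeta>. \<theta> \<zeta> / (\<zeta> - x0) ^ t / (\<zeta> - z))"
    by (rule integrable_cauchy_kernel(1)[OF _ bnd]) (use \<open>0 < R\<close> in auto)
  have ints: "integrable \<nu> (\<lambda>\<zeta>. \<Sum>j<t. \<theta> \<zeta> / (\<zeta> - x0) ^ (t - j) / (z - x0) ^ Suc j)"
    by (intro Bochner_Integration.integrable_sum integrable_divide int)
  have "cauchy_transform \<nu> \<theta> z / (z - x0) ^ t = (LINT \<zeta>|\<nu>. \<theta> \<zeta> / (\<zeta> - z) / (z - x0) ^ t)"
    unfolding cauchy_transform_def by (simp only: integral_divide_zero)
  also have "\<dots> = (LINT \<zeta>|\<nu>. \<theta> \<zeta> / (\<zeta> - x0) ^ t / (\<zeta> - z)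
      + (\<Sum>j<t. \<theta> \<zeta> / (\<zeta> - x0) ^ (t - j) / (z - x0) ^ Suc j))"
  proof (rule integral_cong_AE)
    show "AE \<zeta> in \<nu>. \<theta> \<zeta> / (\<zeta> - z) / (z - x0) ^ t = \<theta> \<zeta> / (\<zeta> - x0) ^ t / (\<zeta> - z)
        + (\<Sum>j<t. \<theta> \<zeta> / (\<zeta> - x0) ^ (t - j) / (z - x0) ^ Suc j)"
      using AE_neq[of z] away
    proof eventually_elim
      case (elim \<zeta>)
      then have "\<zeta> - x0 \<noteq> 0" "z - x0 \<noteq> 0" "\<zeta> - x0 \<noteq> z - x0" using \<open>0 < R\<close> \<open>z \<noteq> x0\<close> by auto
      from partial_fractions[OF this, of t]
      have "\<theta> \<zeta> * (1 / ((\<zeta> - z) * (z - x0) ^ t)) = \<theta> \<zeta> * (1 / ((\<zeta> - x0) ^ t * (\<zeta> - z))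
          + (\<Sum>j<t. 1 / ((\<zeta> - x0) ^ (t - j) * (z - x0) ^ Suc j)))" by simp
      then show ?case by (simp add: distrib_left sum_distrib_left)
    qed
  qed measurable
  also have "\<dots> = (LINT \<zeta>|\<nu>. \<theta> \<zeta> / (\<zeta> - x0) ^ t / (\<zeta> - z))
      + (LINT \<zeta>|\<nu>. (\<Sum>j<t. \<theta> \<zeta> / (\<zeta> - x0) ^ (t - j) / (z - x0) ^ Suc j))"
    by (rule Bochner_Integration.integral_add[OF intk ints])
  also have "(LINT \<zeta>|\<nu>. (\<Sum>j<t. \<theta> \<zeta> / (\<zeta> - x0) ^ (t - j) / (z - x0) ^ Suc j))
      = (\<Sum>j<t. (LINT \<zeta>|\<nu>. \<theta> \<zeta> / (\<zeta> - x0) ^ (t - j) / (z - x0) ^ Suc j))"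
    by (intro Bochner_Integration.integral_sum integrable_divide int)
  finally show ?thesis by (simp only: cauchy_transform_def integral_divide_zero)
qed

end

section \<open>From contents of annuli to test functions\<close>

text \<open>Covering by one unit ball bounds the content, so half of a positive content lies
  strictly below the supremum and is exceeded by some admissible \<open>h\<close>. If the content is
  zero, \<open>h = 0\<close> serves.\<close>

lemma lower_content_le_M_h:
  assumes "E \<subseteq> ball x 1" "-1 < \<alpha>"
  obtains h where "measure_function h" "\<And>r. 0 \<le> r \<Longrightarrow> h r \<le> r powr (1 + \<alpha>)"
    "((\<lambda>r. h r / r powr (1 + \<alpha>)) \<longlongrightarrow> 0) (at_right 0)" "lower_content \<alpha> E \<le> 2 * M_h h E"
    "M_h h E < top"
proof -
  let ?H = "{h. measure_function h \<and> (\<forall>r\<ge>0. h r \<le> r powr (1 + \<alpha>)) \<and>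
        ((\<lambda>r. h r / r powr (1 + \<alpha>)) \<longlongrightarrow> 0) (at_right 0)}"
  have le: "M_h h E \<le> ennreal (2 powr (1 + \<alpha>))" if "h \<in> ?H" for h
    using M_h_subset_ball[OF assms(1), of h] that by (auto intro: order_trans ennreal_leI)
  have "lower_content \<alpha> E \<le> ennreal (2 powr (1 + \<alpha>))"
    unfolding lower_content_def by (rule SUP_least) (rule le)
  then have fin: "lower_content \<alpha> E < top" by (rule le_less_trans) simp
  have "\<exists>h\<in>?H. lower_content \<alpha> E \<le> 2 * M_h h E"
  proof (cases "lower_content \<alpha> E = 0")
    case True
    have "(\<lambda>_. 0) \<in> ?H" by (auto simp: measure_function_def mono_on_def)
    then show ?thesis using True by (intro bexI[of _ "\<lambda>_. 0"]) simp_all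
  next
    case False
    then obtain x where x: "lower_content \<alpha> E = ennreal x" "0 < x"
      using fin by (cases "lower_content \<alpha> E") (auto simp: ennreal_eq_0_iff not_le)
    then have "ennreal (x / 2) < lower_content \<alpha> E" by (simp add: ennreal_less_iff)
    then obtain h where h: "h \<in> ?H" "ennreal (x / 2) < M_h h E"
      unfolding lower_content_def by (auto simp only: less_SUP_iff)
    have "ennreal x = 2 * ennreal (x / 2)" using x by (simp add: ennreal_mult'[symmetric] flip: ennreal_numeral)
    also have "\<dots> \<le> 2 * M_h h E" using h(2) by (intro mult_left_mono) auto
    finally show ?thesis using h(1) x by auto
  qed
  then obtain h where "h \<in> ?H" "lower_content \<alpha> E \<le> 2 * M_h h E" by blast
  moreover have "M_h h E < top" using le[OF \<open>h \<in> ?H\<close>] by (rule le_less_trans) simp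
  ultimately show thesis using that by auto
qed

text \<open>The constant is 49 * 64: the factor 49 comes from Frostman's lemma, and
  \<open>8 powr (1 + \<alpha>)\<close> is at most 64.\<close>

lemma small_growth_measureI:
  assumes "0 < \<alpha>" "\<alpha> < 1" and fin: "finite_measure \<nu>" and sets: "sets \<nu> = sets borel"
    and h: "\<And>r. 0 \<le> r \<Longrightarrow> h r \<le> r powr (1 + \<alpha>)" "((\<lambda>r. h r / r powr (1 + \<alpha>)) \<longlongrightarrow> 0) (at_right 0)"
    and gr: "\<And>z r. 0 < r \<Longrightarrow> emeasure \<nu> (cball z r) \<le> ennreal (49 * h (8 * r))"
  shows "small_growth_measure \<nu> \<alpha> 3136"
proof -
  have *: "emeasure \<nu> (cball z r) \<le> ennreal (3136 * \<epsilon> * r powr (1 + \<alpha>))"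
    if "0 < r" "h (8 * r) \<le> \<epsilon> * (8 * r) powr (1 + \<alpha>)" "0 \<le> \<epsilon>" for z r \<epsilon>
  proof -
    have "8 powr (1 + \<alpha>) \<le> 8 powr (2 :: real)" using assms by (intro powr_mono) auto
    then have "8 powr (1 + \<alpha>) \<le> (64 :: real)" by simp
    then have "\<epsilon> * (8 powr (1 + \<alpha>) * r powr (1 + \<alpha>)) \<le> \<epsilon> * (64 * r powr (1 + \<alpha>))"
      using that by (intro mult_left_mono mult_right_mono) auto
    then have "49 * h (8 * r) \<le> 3136 * \<epsilon> * r powr (1 + \<alpha>)"
      using that by (simp add: powr_mult)
    then show ?thesis using gr[OF that(1)] by (metis ennreal_leI order_trans)
  qed
  interpret finite_measure \<nu> by fact
  show ?thesis
  proof
    show "emeasure \<nu> (cball z r) \<le> ennreal (3136 * r powr (1 + \<alpha>))" if "0 < r" for z r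
      using *[OF that, of 1] h(1)[of "8 * r"] that by simp
    fix \<epsilon> :: real assume "0 < \<epsilon>"
    then have "\<forall>\<^sub>F r in at_right 0. h r / r powr (1 + \<alpha>) < \<epsilon> / 3136"
      using h(2) by (intro order_tendstoD(2)) auto
    then obtain \<delta> where \<delta>: "0 < \<delta>" "\<And>r. 0 < r \<Longrightarrow> r < \<delta> \<Longrightarrow> h r / r powr (1 + \<alpha>) < \<epsilon> / 3136"
      unfolding eventually_at_right_field by auto
    show "\<exists>\<rho>>0. \<forall>z r. 0 < r \<longrightarrow> r \<le> \<rho> \<longrightarrow> emeasure \<nu> (cball z r) \<le> ennreal (\<epsilon> * r powr (1 + \<alpha>))"
    \<comment> \<open>This radius gives \<open>8 * r \<le> \<delta> / 2 < \<delta>\<close>.\<close>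
    proof (intro exI[of _ "\<delta> / 16"] conjI allI impI)
      fix z r assume r: "0 < r" "r \<le> \<delta> / 16"
      then have "h (8 * r) / (8 * r) powr (1 + \<alpha>) < \<epsilon> / 3136" using \<delta>(1) by (intro \<delta>(2)) auto
      then have "h (8 * r) \<le> \<epsilon> / 3136 * (8 * r) powr (1 + \<alpha>)"
        using r by (simp add: pos_divide_less_eq)
      then show "emeasure \<nu> (cball z r) \<le> ennreal (\<epsilon> * r powr (1 + \<alpha>))"
        using *[OF r(1), of "\<epsilon> / 3136" z] \<open>0 < \<epsilon>\<close> by simp
    qed (use \<delta> in simp)
  qed (use assms in auto)
qed

text \<open>Frostman's measure on the closed annulus minus \<open>U\<close>, with the aligning
  phase, supplies everything: \<open>s\<close> is its mass, \<open>f\<close> and \<open>G\<close>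
  are the two Cauchy transforms, and \<open>a\<close> collects the moments from the partial
  fractions. Membership in \<open>A_alpha\<close> is recorded for \<open>G\<close>, the function to
  be paired with the representing measure.\<close>

lemma annulus_test_functions:
  assumes \<alpha>: "0 < \<alpha>" "\<alpha> < 1" and "open U" and n: "2 \<le> n"
  obtains f G :: "complex \<Rightarrow> complex" and a :: "nat \<Rightarrow> complex" and s :: real where
    "0 \<le> s" "lower_content \<alpha> (annulus x0 n - U) \<le> ennreal (2 * s)" "G \<in> A_alpha \<alpha> U"
    "\<And>z. z \<noteq> x0 \<Longrightarrow> cmod (f z) \<le>
       6272 * (2 / (1 - 2 powr (- \<alpha>)) + 1) * min 1 ((1 / 2) ^ n / cmod (z - x0))"
    "\<And>z. z \<noteq> x0 \<Longrightarrow> f z / (z - x0) ^ t = G z + (\<Sum>j<t. a (t - j) / (z - x0) ^ Suc j)"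
    "2 ^ (n * Suc t) * s \<le> Re (G x0)"
    "\<And>i. i \<le> t \<Longrightarrow> cmod (a i) \<le> 2 ^ (Suc n * t) * s"
proof -
  \<comment> \<open>The closed annulus makes \<open>K\<close> compact; it contains the open annulus
    minus \<open>U\<close> and stays at distance at least \<open>(1 / 2) ^ Suc n\<close> from
    \<open>x0\<close>.\<close>
  define K where "K = (cball x0 ((1 / 2) ^ n) - ball x0 ((1 / 2) ^ Suc n)) - U"
  have "compact K" unfolding K_def
    using \<open>open U\<close> by (intro compact_diff) auto
  have KD: "(1 / 2) ^ Suc n \<le> cmod (z - x0)" "cmod (z - x0) \<le> (1 / 2) ^ n" if "z \<in> K" for z
    using that by (auto simp: K_def dist_norm norm_minus_commute)
  have quarter: "(1 / 2 :: real) ^ n \<le> 1 / 4"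
    using power_decreasing[OF n, of "1 / 2 :: real"] by (simp add: power2_eq_square)
  \<comment> \<open>The square is centred at \<open>x0\<close>; radius at most 1/4, from
    \<open>2 \<le> n\<close>, leaves room on all sides.\<close>
  have Ksq: "K \<subseteq> unit_square (x0 - Complex (1 / 2) (1 / 2))"
  proof
    fix z assume "z \<in> K"
    then have "cmod (z - x0) \<le> 1 / 4" using KD quarter by fastforce
    then have "\<bar>Re (z - x0)\<bar> \<le> 1 / 4" "\<bar>Im (z - x0)\<bar> \<le> 1 / 4"
      using abs_Re_le_cmod[of "z - x0"] abs_Im_le_cmod[of "z - x0"] by linarith+
    then show "z \<in> unit_square (x0 - Complex (1 / 2) (1 / 2))" 
      unfolding unit_square_def mem_Collect_eq minus_complex.sel complex.sel by linarith
  qed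
  have ann: "annulus x0 n - U \<subseteq> K"
    by (auto simp: annulus_def K_def dist_norm norm_minus_commute powr_diff powr_minus_divide
        powr_realpow power_one_over field_simps)
  have Kball: "K \<subseteq> ball x0 1"
    using KD quarter by (fastforce simp: dist_norm norm_minus_commute)
  obtain h where h: "measure_function h" "\<And>r. 0 \<le> r \<Longrightarrow> h r \<le> r powr (1 + \<alpha>)"
    "((\<lambda>r. h r / r powr (1 + \<alpha>)) \<longlongrightarrow> 0) (at_right 0)"
    "lower_content \<alpha> (annulus x0 n - U) \<le> 2 * M_h h (annulus x0 n - U)"
    by (rule lower_content_le_M_h[of "annulus x0 n - U" x0 \<alpha>]) (use ann Kball \<alpha> in auto)
  obtain \<nu> where \<nu>: "sets \<nu> = sets borel" "finite_measure \<nu>" "emeasure \<nu> UNIV = M_h h K" "AE z in \<nu>. z \<in> K"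
    "\<And>z r. 0 < r \<Longrightarrow> emeasure \<nu> (cball z r) \<le> ennreal (49 * h (8 * r))"
    using frostman[OF \<open>compact K\<close> Ksq h(1)] by metis
  interpret small_growth_measure \<nu> \<alpha> 3136
    by (rule small_growth_measureI[OF \<alpha> \<nu>(2,1) h(2,3) \<nu>(5)])
  have sp: "space \<nu> = UNIV" using sets_eq_imp_space_eq[OF \<nu>(1)] by simp
  define s where "s = measure \<nu> UNIV"
  \<comment> \<open>The exponent \<open>Suc t\<close> cancels the argument of
    \<open>(\<zeta> - x0) ^ Suc t\<close>, the full denominator in the integral for
    \<open>G x0\<close>.\<close>
  define \<theta> where "\<theta> \<zeta> = sgn (\<zeta> - x0) ^ Suc t" for \<zeta>
  have [measurable]: "\<theta> \<in> borel_measurable borel"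
    unfolding \<theta>_def sgn_div_norm by measurable
  have \<theta>1: "cmod (\<theta> \<zeta>) \<le> 1" for \<zeta>
    unfolding \<theta>_def norm_power by (rule power_le_one) (auto simp: norm_sgn)
  define G where "G = cauchy_transform \<nu> (\<lambda>\<zeta>. \<theta> \<zeta> / (\<zeta> - x0) ^ t)"
  define a where "a i = (LINT \<zeta>|\<nu>. \<theta> \<zeta> / (\<zeta> - x0) ^ i)" for i
  let ?R = "(1 / 2 :: real) ^ Suc n"
  have away: "AE \<zeta> in \<nu>. ?R \<le> cmod (\<zeta> - x0)" using \<nu>(4) by eventually_elim (rule KD)
  have close: "AE \<zeta> in \<nu>. cmod (\<zeta> - x0) \<le> (1 / 2) ^ n" using \<nu>(4) by eventually_elim (rule KD)
  have bnd: "AE \<zeta> in \<nu>. cmod (\<theta> \<zeta> / (\<zeta> - x0) ^ i) \<le> 2 ^ (Suc n * i)" for i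
    using away
  proof eventually_elim
    case (elim \<zeta>)
    have "cmod (\<theta> \<zeta>) / cmod (\<zeta> - x0) ^ i \<le> 1 / ?R ^ i"
      using \<theta>1 elim by (intro frac_le power_mono) auto
    also have "\<dots> = 2 ^ (Suc n * i)" by (simp only: power_mult power_one_over) simp
    finally show ?case by (simp add: norm_divide norm_power)
  qed
  show thesis
  proof (rule that[of s G "cauchy_transform \<nu> \<theta>" a])
    show s0: "0 \<le> s" by (simp add: s_def)
    have "lower_content \<alpha> (annulus x0 n - U) \<le> 2 * M_h h K"
      using h(4) mult_left_mono[OF M_h_mono[OF ann, of h], of 2] by (auto intro: order_trans)
    also have "M_h h K = ennreal s" using \<nu>(3) by (simp add: emeasure_eq_measure s_def)
    also have "2 * ennreal s = ennreal (2 * s)" using s0 by (simp add: ennreal_mult)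
    finally show "lower_content \<alpha> (annulus x0 n - U) \<le> ennreal (2 * s)" .
    have "G analytic_on U" unfolding G_def
      by (rule analytic_cauchy_transform[OF finite_measure_axioms sets_\<nu> _ bnd \<nu>(4) \<open>open U\<close>])
        (auto simp: K_def)
    moreover have "G \<in> lip \<alpha>" unfolding G_def by (rule cauchy_transform_in_lip[OF _ bnd]) auto
    ultimately show "G \<in> A_alpha \<alpha> U" by (simp add: A_alpha_def)
    show "cmod (cauchy_transform \<nu> \<theta> z) \<le>
       6272 * (2 / (1 - 2 powr (- \<alpha>)) + 1) * min 1 ((1 / 2) ^ n / cmod (z - x0))" if "z \<noteq> x0" for z
      \<comment> \<open>The constant 6272 is twice the growth constant 3136.\<close>
      using cauchy_transform_decay[OF _ _ _ _ close that, of \<theta>] \<theta>1 by (simp add: power_le_one)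
    show "cauchy_transform \<nu> \<theta> z / (z - x0) ^ t = G z + (\<Sum>j<t. a (t - j) / (z - x0) ^ Suc j)"
      if "z \<noteq> x0" for z
      unfolding G_def a_def by (rule cauchy_transform_divide_power[OF _ _ _ away that]) (use \<theta>1 in auto)
    show "cmod (a i) \<le> 2 ^ (Suc n * t) * s" if "i \<le> t" for i
    proof -
      have "cmod (a i) \<le> (LINT \<zeta>|\<nu>. 2 ^ (Suc n * i))"
        unfolding a_def by (rule norm_integral_le_AE[OF _ bnd]) simp
      also have "\<dots> = 2 ^ (Suc n * i) * s" by (simp add: s_def sp)
      also have "\<dots> \<le> 2 ^ (Suc n * t) * s"
        using s0 that by (intro mult_right_mono power_increasing mult_le_mono2) auto
      finally show ?thesis .
    qed
    have "2 ^ (n * Suc t) * s = (LINT \<zeta>|\<nu>. 2 ^ (n * Suc t))" by (simp add: s_def sp)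
    also have "\<dots> \<le> (LINT \<zeta>|\<nu>. (1 / cmod (\<zeta> - x0)) ^ Suc t)"
    proof (rule integral_mono_AE)
      show "integrable \<nu> (\<lambda>\<zeta>. (1 / cmod (\<zeta> - x0)) ^ Suc t)"
      proof (rule integrable_const_bound[where B = "(1 / ?R) ^ Suc t"])
        show "AE \<zeta> in \<nu>. norm ((1 / cmod (\<zeta> - x0)) ^ Suc t) \<le> (1 / ?R) ^ Suc t"
          using away
        proof eventually_elim
          case (elim \<zeta>)
          have "(1 / cmod (\<zeta> - x0)) ^ Suc t \<le> (1 / ?R) ^ Suc t"
            using elim by (intro power_mono frac_le) auto
          then show ?case by (simp only: real_norm_def abs_of_nonneg zero_le_power zero_le_divide_1_iff norm_ge_zero)
        qed
      qed measurable
      show "AE \<zeta> in \<nu>. 2 ^ (n * Suc t) \<le> (1 / cmod (\<zeta> - x0)) ^ Suc t"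
        using close away
      proof eventually_elim
        case (elim \<zeta>)
        have "0 < cmod (\<zeta> - x0)" using elim(2) by (rule less_le_trans[rotated]) simp
        then have "1 / (1 / 2) ^ n \<le> 1 / cmod (\<zeta> - x0)" using elim(1) by (intro frac_le) auto
        then have "(2 ^ n) ^ Suc t \<le> (1 / cmod (\<zeta> - x0)) ^ Suc t"
          by (intro power_mono) (auto simp: power_one_over)
        then show ?case by (simp only: power_mult)
      qed
    qed simp
    also have "\<dots> = Re (LINT \<zeta>|\<nu>. complex_of_real ((1 / cmod (\<zeta> - x0)) ^ Suc t))"
      by (simp only: integral_complex_of_real Re_complex_of_real)
    \<comment> \<open>The integrands agree everywhere, including \<open>\<zeta> = x0\<close>, where
      both are 0 by the conventions for \<open>sgn\<close> and division.\<close>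
    also have "(LINT \<zeta>|\<nu>. complex_of_real ((1 / cmod (\<zeta> - x0)) ^ Suc t)) = G x0"
      unfolding G_def cauchy_transform_def
    proof (rule Bochner_Integration.integral_cong[OF refl])
      fix \<zeta>
      show "complex_of_real ((1 / cmod (\<zeta> - x0)) ^ Suc t) = \<theta> \<zeta> / (\<zeta> - x0) ^ t / (\<zeta> - x0)"
      proof -
        have "\<theta> \<zeta> / (\<zeta> - x0) ^ t / (\<zeta> - x0) = (sgn (\<zeta> - x0) / (\<zeta> - x0)) ^ Suc t"
          unfolding \<theta>_def power_divide by (simp add: mult.commute)
        also have "sgn (\<zeta> - x0) / (\<zeta> - x0) = complex_of_real (1 / cmod (\<zeta> - x0))"
          by (cases "\<zeta> = x0") (auto simp: sgn_eq)
        finally show ?thesis by (simp only: of_real_power)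
      qed
    qed
    finally show "2 ^ (n * Suc t) * s \<le> Re (G x0)" .
  qed
qed

section \<open>Dyadic sums against a power weight\<close>

lemma sum_power_inj_le:
  fixes q :: real
  assumes "finite A" "inj_on f A" "0 \<le> q" "q < 1"
  shows "(\<Sum>n\<in>A. q ^ f n) \<le> 1 / (1 - q)"
proof -
  have "(\<Sum>n\<in>A. q ^ f n) = (\<Sum>k\<in>f ` A. q ^ k)" using assms(2) by (simp add: sum.reindex)
  also have "\<dots> \<le> (\<Sum>k. q ^ k)" using assms by (intro sum_le_suminf summable_geometric) auto
  also have "\<dots> = 1 / (1 - q)" using assms by (simp add: suminf_geometric)
  finally show ?thesis .
qed

text \<open>The terms grow like \<open>2 powr (lam * n)\<close> while
  \<open>2 ^ n * \<rho> \<le> 1\<close> and decay like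
  \<open>2 powr (- (1 - lam) * n) / \<rho>\<close> afterwards. Both pieces are geometric sums
  dominated by their terms nearest the crossover, which are of size
  \<open>\<rho> powr (- lam)\<close>.\<close>

lemma dyadic_weighted_sum_le:
  fixes lam \<rho> :: real
  assumes lam: "0 < lam" "lam < 1" and \<rho>: "0 < \<rho>" and A: "finite A"
  shows "(\<Sum>n\<in>A. 2 powr (lam * real n) * min 1 ((1 / 2) ^ n / \<rho>))
    \<le> (1 / (1 - 2 powr (- lam)) + 1 / (1 - 2 powr (- (1 - lam)))) * \<rho> powr (- lam)"
proof -
  define A1 A2 where "A1 = {n\<in>A. 2 ^ n * \<rho> \<le> 1}" and "A2 = {n\<in>A. \<not> 2 ^ n * \<rho> \<le> 1}"
  let ?u = "\<lambda>n. 2 powr (lam * real n) * min 1 ((1 / 2) ^ n / \<rho>)"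
  have fin: "finite A1" "finite A2" using A by (auto simp: A1_def A2_def)
  have q: "2 powr (- lam) < 1" "2 powr (- (1 - lam)) < 1"
    using powr_neg_less_1[of lam] powr_neg_less_1[of "1 - lam"] lam by auto
  have 1: "(\<Sum>n\<in>A1. ?u n) \<le> 1 / (1 - 2 powr (- lam)) * \<rho> powr (- lam)"
  proof (cases "A1 = {}")
    case True
    then show ?thesis using q by simp
  next
    case False
    \<comment> \<open>The rising part is summed downwards from its last index, where
      \<open>2 ^ m \<le> 1 / \<rho>\<close>.\<close>
    define m where "m = Max A1"
    have m: "m \<in> A1" "\<And>n. n \<in> A1 \<Longrightarrow> n \<le> m" using False fin by (auto simp: m_def)
    have "(\<Sum>n\<in>A1. ?u n) \<le> (\<Sum>n\<in>A1. 2 powr (lam * real m) * (2 powr (- lam)) ^ (m - n))"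
    proof (rule sum_mono)
      fix n assume "n \<in> A1"
      then have "n \<le> m" using m by blast
      have "?u n \<le> 2 powr (lam * real n) * 1" by (intro mult_left_mono) auto
      also have "\<dots> = 2 powr (lam * real m) * (2 powr (- lam)) ^ (m - n)"
        using \<open>n \<le> m\<close> by (simp add: powr_power of_nat_diff algebra_simps flip: powr_add)
      finally show "?u n \<le> 2 powr (lam * real m) * (2 powr (- lam)) ^ (m - n)" .
    qed
    also have "\<dots> = 2 powr (lam * real m) * (\<Sum>n\<in>A1. (2 powr (- lam)) ^ (m - n))"
      by (simp add: sum_distrib_left)
    also have "\<dots> \<le> \<rho> powr (- lam) * (1 / (1 - 2 powr (- lam)))"
    proof (intro mult_mono sum_power_inj_le)
      show "inj_on (\<lambda>n. m - n) A1" using m(2) by (intro inj_onI) (metis diff_diff_cancel)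
      have "2 ^ m \<le> 1 / \<rho>" using m(1) \<rho> by (simp add: A1_def field_simps)
      then have "(2 ^ m) powr lam \<le> (1 / \<rho>) powr lam" using lam by (intro powr_mono2) auto
      then show "2 powr (lam * real m) \<le> \<rho> powr (- lam)"
        using \<rho> by (simp add: powr_minus_divide powr_divide powr_powr mult.commute flip: powr_realpow)
    qed (use q fin in \<open>auto intro!: sum_nonneg\<close>)
    finally show ?thesis by (simp only: mult.commute)
  qed
  have 2: "(\<Sum>n\<in>A2. ?u n) \<le> 1 / (1 - 2 powr (- (1 - lam))) * \<rho> powr (- lam)"
  proof (cases "A2 = {}")
    case True
    then show ?thesis using q by simp
  next
    case False
    let ?q = "2 powr (- (1 - lam))"
    \<comment> \<open>The falling part is summed upwards from its first index, where
      \<open>(1 / 2) ^ m < \<rho>\<close>.\<close>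
    define m where "m = Min A2"
    have m: "m \<in> A2" "\<And>n. n \<in> A2 \<Longrightarrow> m \<le> n" using False fin by (auto simp: m_def)
    have "(\<Sum>n\<in>A2. ?u n) \<le> (\<Sum>n\<in>A2. ?q ^ m / \<rho> * ?q ^ (n - m))"
    proof (rule sum_mono)
      fix n assume "n \<in> A2"
      then have "m \<le> n" using m by blast
      have "?u n \<le> 2 powr (lam * real n) * ((1 / 2) ^ n / \<rho>)" by (intro mult_left_mono) auto
      also have "\<dots> = 2 powr (lam * real n - real n) / \<rho>"
        by (simp add: powr_diff powr_realpow power_one_over)
      also have "lam * real n - real n = - (1 - lam) * real m + - (1 - lam) * real (n - m)"
        using \<open>m \<le> n\<close> by (simp add: of_nat_diff algebra_simps)
      also have "2 powr \<dots> / \<rho> = ?q ^ m / \<rho> * ?q ^ (n - m)"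
        by (simp add: powr_add powr_power mult.commute)
      finally show "?u n \<le> ?q ^ m / \<rho> * ?q ^ (n - m)" .
    qed
    also have "\<dots> = ?q ^ m / \<rho> * (\<Sum>n\<in>A2. ?q ^ (n - m))" by (simp add: sum_distrib_left)
    also have "\<dots> \<le> \<rho> powr (- lam) * (1 / (1 - ?q))"
    proof (intro mult_mono sum_power_inj_le)
      show "inj_on (\<lambda>n. n - m) A2" using m(2) by (intro inj_onI) (metis le_add_diff_inverse)
      have "(1 / 2) ^ m \<le> \<rho>" using m(1) \<rho> by (simp add: A2_def field_simps)
      then have "((1 / 2) ^ m) powr (1 - lam) \<le> \<rho> powr (1 - lam)" using lam by (intro powr_mono2) auto
      moreover have "((1 / 2 :: real) ^ m) powr (1 - lam) = ?q ^ m"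
      proof -
        have "(1 / 2 :: real) ^ m = 2 powr (- real m)" by (simp add: powr_minus_divide powr_realpow power_one_over)
        then show ?thesis by (simp add: powr_powr powr_power algebra_simps)
      qed
      ultimately have "?q ^ m / \<rho> \<le> \<rho> powr (1 - lam) / \<rho>" using \<rho> by (intro divide_right_mono) auto
      also have "\<dots> = \<rho> powr (- lam)" using \<rho> by (simp add: powr_diff powr_minus_divide)
      finally show "?q ^ m / \<rho> \<le> \<rho> powr (- lam)" .
    qed (use q fin \<rho> in \<open>auto intro!: sum_nonneg\<close>)
    finally show ?thesis by (simp only: mult.commute)
  qed
  have "(\<Sum>n\<in>A. ?u n) = (\<Sum>n\<in>A1. ?u n) + (\<Sum>n\<in>A2. ?u n)"
    using A by (subst sum.union_disjoint[symmetric]) (auto simp: A1_def A2_def intro!: sum.cong)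
  then show ?thesis using 1 2 by (simp only: distrib_right)
qed

section \<open>Representing measures with finite potential\<close>

text \<open>In \<open>potential\<close> the kernel is infinite at \<open>x0\<close>, so finiteness
  makes \<open>x0\<close> a null point; elsewhere the extended reciprocal is the real power.\<close>

lemma finite_potential:
  assumes fin: "potential \<mu> \<tau> x0 \<noteq> \<infinity>" and sets [measurable_cong]: "sets \<mu> = sets borel" and "0 < \<tau>"
  shows "AE z in \<mu>. z \<noteq> x0" and "integrable \<mu> (\<lambda>z. cmod (z - x0) powr (- \<tau>))"
proof -
  have meas: "(\<lambda>z. inverse (ennreal (cmod (z - x0) powr \<tau>))) \<in> borel_measurable \<mu>" by measurable
  have "AE z in \<mu>. inverse (ennreal (cmod (z - x0) powr \<tau>)) \<noteq> \<infinity>"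
    using nn_integral_PInf_AE[OF meas] fin by (simp add: potential_def)
  then show ne: "AE z in \<mu>. z \<noteq> x0" by eventually_elim auto
  have "(\<integral>\<^sup>+ z. ennreal (cmod (z - x0) powr (- \<tau>)) \<partial>\<mu>) = potential \<mu> \<tau> x0"
    unfolding potential_def
  proof (rule nn_integral_cong_AE, use ne in eventually_elim)
    case (elim z)
    then show ?case by (simp add: inverse_ennreal powr_minus)
  qed
  then show "integrable \<mu> (\<lambda>z. cmod (z - x0) powr (- \<tau>))"
    using fin by (intro integrableI_nonneg) (auto simp: less_top)
qed

text \<open>Makes every \<open>(z - x0) ^ k\<close> with \<open>k \<le> t\<close> integrable in
  reciprocal against a finite measure of finite potential.\<close>

lemma inverse_power_le_powr:
  fixes x :: real
  assumes "0 < x" "real k \<le> \<tau>"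
  shows "1 / x ^ k \<le> 1 + x powr (- \<tau>)"
proof (cases "1 \<le> x")
  case True
  then have "1 / x ^ k \<le> 1" by (simp add: one_le_power divide_le_eq_1)
  then show ?thesis by (simp add: add_increasing2)
next
  case False
  have "1 / x ^ k = x powr (- real k)" using assms by (simp add: powr_minus_divide powr_realpow)
  also have "\<dots> \<le> x powr (- \<tau>)" using assms False by (intro powr_mono') auto
  finally show ?thesis by simp
qed

text \<open>The integrals of \<open>f n z / (z - x0) ^ t\<close> against the representing measure
  are estimated twice: from above by the pointwise bound on \<open>f n\<close>, summed over
  \<open>n\<close>, and from below by \<open>G n x0\<close> minus lower-order terms.\<close>

lemma weighted_masses_bounded:
  fixes f G :: "nat \<Rightarrow> complex \<Rightarrow> complex" and a :: "nat \<Rightarrow> nat \<Rightarrow> complex" and s :: "nat \<Rightarrow> real"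
  assumes rep: "representing_measure \<alpha> U x0 \<mu> \<gamma>" and fin: "potential \<mu> (real t + lam) x0 \<noteq> \<infinity>"
    and lam: "0 < lam" "lam < 1" and "0 \<le> B"
    and s: "\<And>n. n \<in> I \<Longrightarrow> 0 \<le> s n"
    and G: "\<And>n. n \<in> I \<Longrightarrow> G n \<in> A_alpha \<alpha> U"
    and f: "\<And>n z. n \<in> I \<Longrightarrow> z \<noteq> x0 \<Longrightarrow> cmod (f n z) \<le> B * min 1 ((1 / 2) ^ n / cmod (z - x0))"
    and fG: "\<And>n z. n \<in> I \<Longrightarrow> z \<noteq> x0 \<Longrightarrow>
       f n z / (z - x0) ^ t = G n z + (\<Sum>j<t. a n (t - j) / (z - x0) ^ Suc j)"
    and Gx0: "\<And>n. n \<in> I \<Longrightarrow> 2 ^ (n * Suc t) * s n \<le> Re (G n x0)"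
    and a: "\<And>n i. n \<in> I \<Longrightarrow> i \<le> t \<Longrightarrow> cmod (a n i) \<le> 2 ^ (Suc n * t) * s n"
  shows "\<exists>N Q. 0 \<le> Q \<and> (\<forall>A. finite A \<longrightarrow> A \<subseteq> I \<inter> {N..} \<longrightarrow>
     (\<Sum>n\<in>A. 2 powr ((real t + lam + 1) * real n) * s n) \<le> Q)"
proof -
  define \<tau> where "\<tau> = real t + lam"
  have \<tau>: "0 < \<tau>" using lam by (simp add: \<tau>_def)
  have cm: "complex_measure \<mu> \<gamma>" and
    repf: "\<And>f. f \<in> A_alpha \<alpha> U \<Longrightarrow> integrable \<mu> (\<lambda>z. f z * \<gamma> z) \<and> (LINT z|\<mu>. f z * \<gamma> z) = f x0"
    using rep by (auto simp: representing_measure_def)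
  have sets [measurable_cong]: "sets \<mu> = sets borel" and "finite_measure \<mu>"
    and \<gamma>m [measurable]: "\<gamma> \<in> borel_measurable \<mu>" and \<gamma>: "AE z in \<mu>. cmod (\<gamma> z) = 1"
    using cm by (auto simp: complex_measure_def)
  interpret finite_measure \<mu> by fact
  note ne = finite_potential(1)[OF fin[folded \<tau>_def] sets \<tau>]
    and pint = finite_potential(2)[OF fin[folded \<tau>_def] sets \<tau>]
  have kint: "integrable \<mu> (\<lambda>z. \<gamma> z / (z - x0) ^ Suc j)" if "j < t" for j
  proof (rule Bochner_Integration.integrable_bound)
    show "integrable \<mu> (\<lambda>z. 1 + cmod (z - x0) powr (- \<tau>))" using pint by simp
    show "AE z in \<mu>. cmod (\<gamma> z / (z - x0) ^ Suc j) \<le> norm (1 + cmod (z - x0) powr (- \<tau>))"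
      using ne \<gamma>
    proof eventually_elim
      case (elim z)
      have "1 / cmod (z - x0) ^ Suc j \<le> 1 + cmod (z - x0) powr (- \<tau>)"
        using elim that lam by (intro inverse_power_le_powr) (auto simp: \<tau>_def)
      then show ?case using elim by (simp add: norm_divide norm_power norm_mult)
    qed
  qed measurable
  \<comment> \<open>These moments of the representing measure do not depend on \<open>n\<close>;
    that is why the correction terms are eventually dominated.\<close>
  define c where "c j = (LINT z|\<mu>. \<gamma> z / (z - x0) ^ Suc j)" for j
  define S where "S n = 2 powr ((real t + lam + 1) * real n) * s n" for n
  \<comment> \<open>Off the null point \<open>x0\<close> this is
    \<open>f n z / (z - x0) ^ t * \<gamma> z\<close>. In this form every summand is visibly
    integrable and the value of the integral can be read off.\<close>
  define \<Phi> where "\<Phi> n z = G n z * \<gamma> z + (\<Sum>j<t. a n (t - j) * (\<gamma> z / (z - x0) ^ Suc j))" for n z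
  have \<Phi>int: "integrable \<mu> (\<Phi> n)" if "n \<in> I" for n
    unfolding \<Phi>_def using repf[OF G[OF that]] kint
    by (intro Bochner_Integration.integrable_add Bochner_Integration.integrable_sum integrable_mult_right) auto
  have \<Phi>val: "(LINT z|\<mu>. \<Phi> n z) = G n x0 + (\<Sum>j<t. a n (t - j) * c j)" if "n \<in> I" for n
  proof -
    have "(LINT z|\<mu>. \<Phi> n z) = (LINT z|\<mu>. G n z * \<gamma> z)
        + (LINT z|\<mu>. (\<Sum>j<t. a n (t - j) * (\<gamma> z / (z - x0) ^ Suc j)))"
      unfolding \<Phi>_def using repf[OF G[OF that]] kint
      by (intro Bochner_Integration.integral_add Bochner_Integration.integrable_sum integrable_mult_right) auto
    also have "(LINT z|\<mu>. (\<Sum>j<t. a n (t - j) * (\<gamma> z / (z - x0) ^ Suc j)))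
        = (\<Sum>j<t. (LINT z|\<mu>. a n (t - j) * (\<gamma> z / (z - x0) ^ Suc j)))"
      using kint by (intro Bochner_Integration.integral_sum integrable_mult_right) auto
    finally show ?thesis using repf[OF G[OF that]] by (simp only: integral_mult_right_zero c_def)
  qed
  define Cl where "Cl = 1 / (1 - 2 powr (- lam)) + 1 / (1 - 2 powr (- (1 - lam)))"
  define P where "P = (LINT z|\<mu>. cmod (z - x0) powr (- \<tau>))"
  have P0: "0 \<le> P" unfolding P_def by (intro integral_nonneg_AE) auto
  have Cl0: "0 \<le> Cl" unfolding Cl_def
    using powr_neg_less_1[of lam] powr_neg_less_1[of "1 - lam"] lam by simp
  define c' where "c' = (\<Sum>j<t. cmod (c j))"
  have c'0: "0 \<le> c'" by (auto simp: c'_def intro: sum_nonneg)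
  \<comment> \<open>From this index on the correction, of order
    \<open>2 ^ (Suc n * t) * s n * c'\<close>, is at most half of the main term
    \<open>2 ^ (n * Suc t) * s n\<close>.\<close>
  obtain N where N: "2 ^ Suc t * c' < 2 ^ N" using real_arch_pow[of 2] by auto
  have upper: "cmod (\<Sum>n\<in>A. 2 powr (lam * real n) * (LINT z|\<mu>. \<Phi> n z)) \<le> B * Cl * P"
    if A: "finite A" "A \<subseteq> I" for A
  proof -
    have "(\<Sum>n\<in>A. 2 powr (lam * real n) * (LINT z|\<mu>. \<Phi> n z))
        = (\<Sum>n\<in>A. (LINT z|\<mu>. complex_of_real (2 powr (lam * real n)) * \<Phi> n z))"
      by (simp only: integral_mult_right_zero)
    also have "\<dots> = (LINT z|\<mu>. (\<Sum>n\<in>A. complex_of_real (2 powr (lam * real n)) * \<Phi> n z))"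
      using \<Phi>int A by (intro Bochner_Integration.integral_sum[symmetric] integrable_mult_right) auto
    also have "cmod \<dots> \<le> (LINT z|\<mu>. B * Cl * cmod (z - x0) powr (- \<tau>))"
    proof (rule norm_integral_le_AE)
      show "integrable \<mu> (\<lambda>z. B * Cl * cmod (z - x0) powr (- \<tau>))"
        using pint by (rule integrable_mult_right)
      show "AE z in \<mu>. cmod (\<Sum>n\<in>A. complex_of_real (2 powr (lam * real n)) * \<Phi> n z)
          \<le> B * Cl * cmod (z - x0) powr (- \<tau>)"
        using ne \<gamma>
      proof eventually_elim
        case (elim z)
        define \<rho> where "\<rho> = cmod (z - x0)"
        have \<rho>: "0 < \<rho>" using elim by (simp add: \<rho>_def)
        have eq: "\<Phi> n z = f n z * (\<gamma> z / (z - x0) ^ t)" if "n \<in> I" for n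
        proof -
          have "\<Phi> n z = (f n z / (z - x0) ^ t) * \<gamma> z"
            unfolding fG[OF that elim(1)] \<Phi>_def by (simp add: distrib_right sum_distrib_right)
          then show ?thesis by simp
        qed
        have "(\<Sum>n\<in>A. complex_of_real (2 powr (lam * real n)) * \<Phi> n z)
            = (\<Sum>n\<in>A. complex_of_real (2 powr (lam * real n)) * f n z) * (\<gamma> z / (z - x0) ^ t)"
          unfolding sum_distrib_right using eq A by (intro sum.cong) (auto simp: mult.assoc)
        then have "cmod (\<Sum>n\<in>A. complex_of_real (2 powr (lam * real n)) * \<Phi> n z)
            = cmod (\<Sum>n\<in>A. complex_of_real (2 powr (lam * real n)) * f n z) * (1 / \<rho> ^ t)"
          using elim by (simp add: norm_mult norm_divide norm_power \<rho>_def)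
        also have "\<dots> \<le> (\<Sum>n\<in>A. 2 powr (lam * real n) * (B * min 1 ((1 / 2) ^ n / \<rho>))) * (1 / \<rho> ^ t)"
        proof (intro mult_right_mono sum_norm_le)
          fix n assume "n \<in> A"
          then have "cmod (f n z) \<le> B * min 1 ((1 / 2) ^ n / \<rho>)"
            using f[of n z] elim A by (auto simp: \<rho>_def)
          then show "cmod (complex_of_real (2 powr (lam * real n)) * f n z)
              \<le> 2 powr (lam * real n) * (B * min 1 ((1 / 2) ^ n / \<rho>))"
            unfolding norm_mult by (intro mult_mono) auto
        qed (use \<rho> in auto)
        also have "\<dots> = B * (\<Sum>n\<in>A. 2 powr (lam * real n) * min 1 ((1 / 2) ^ n / \<rho>)) * (1 / \<rho> ^ t)"
          by (simp add: sum_distrib_left mult_ac)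
        also have "\<dots> \<le> B * (Cl * \<rho> powr (- lam)) * (1 / \<rho> ^ t)"
          unfolding Cl_def using \<rho> \<open>0 \<le> B\<close> A(1) lam
          by (intro mult_right_mono mult_left_mono dyadic_weighted_sum_le) auto
        also have "\<dots> = B * Cl * \<rho> powr (- \<tau>)"
        proof -
          have "\<rho> powr (- \<tau>) = \<rho> powr (- lam) * (1 / \<rho> ^ t)"
            using \<rho> powr_add[of \<rho> "- real t" "- lam"]
            by (simp add: \<tau>_def powr_minus_divide powr_realpow mult.commute)
          then show ?thesis by simp
        qed
        finally show ?case by (simp add: \<rho>_def)
      qed
    qed
    also have "\<dots> = B * Cl * P" by (simp add: P_def)
    finally show ?thesis .
  qed
  have "(\<Sum>n\<in>A. S n) \<le> 2 * (B * Cl * P)" if A: "finite A" "A \<subseteq> I \<inter> {N..}" for A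
  proof -
    \<comment> \<open>Real parts are compared term by term, so that the lower bounds add up without
      cancellation, while the modulus is taken only of the whole sum.\<close>
    have term_ge: "S n / 2 \<le> Re (2 powr (lam * real n) * (LINT z|\<mu>. \<Phi> n z))" if "n \<in> A" for n
    proof -
      have nI: "n \<in> I" "N \<le> n" using that A by auto
      have "cmod (\<Sum>j<t. a n (t - j) * c j) \<le> (\<Sum>j<t. 2 ^ (Suc n * t) * s n * cmod (c j))"
        unfolding norm_mult[symmetric]
        by (rule sum_norm_le) (use a[OF nI(1)] in \<open>auto simp: norm_mult intro!: mult_right_mono\<close>)
      also have "\<dots> = 2 ^ (Suc n * t) * s n * c'" by (simp add: c'_def sum_distrib_left)
      also have "\<dots> = 2 ^ (n * t) * s n * (2 ^ t * c')" by (simp add: power_add algebra_simps)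
      also have "\<dots> \<le> 2 ^ (n * t) * s n * (2 ^ n / 2)"
      proof (rule mult_left_mono)
        have "2 ^ Suc t * c' \<le> 2 ^ n" using N nI(2) power_increasing[OF nI(2), of "2 :: real"] by linarith
        then show "2 ^ t * c' \<le> 2 ^ n / 2" by simp
      qed (use s[OF nI(1)] in auto)
      also have "\<dots> = 2 ^ (n * Suc t) * s n / 2" by (simp add: power_add)
      finally have "cmod (\<Sum>j<t. a n (t - j) * c j) \<le> 2 ^ (n * Suc t) * s n / 2" .
      then have "2 ^ (n * Suc t) * s n / 2 \<le> Re (LINT z|\<mu>. \<Phi> n z)"
        using Gx0[OF nI(1)] abs_Re_le_cmod[of "\<Sum>j<t. a n (t - j) * c j"] unfolding \<Phi>val[OF nI(1)]
        by simp
      then have "2 powr (lam * real n) * (2 ^ (n * Suc t) * s n / 2) \<le> 2 powr (lam * real n) * Re (LINT z|\<mu>. \<Phi> n z)"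
        by (intro mult_left_mono) auto
      moreover have "2 powr (lam * real n) * (2 ^ (n * Suc t) * s n / 2) = S n / 2"
      proof -
        have "(2 :: real) ^ (n * Suc t) = 2 powr (real n * (real t + 1))"
          by (subst powr_realpow[symmetric]) (auto simp: algebra_simps)
        then have "2 powr (lam * real n) * 2 ^ (n * Suc t) = 2 powr ((real t + lam + 1) * real n)"
          by (simp add: algebra_simps flip: powr_add)
        then show ?thesis by (simp add: S_def)
      qed
      moreover have "Re (2 powr (lam * real n) * (LINT z|\<mu>. \<Phi> n z))
          = 2 powr (lam * real n) * Re (LINT z|\<mu>. \<Phi> n z)" by simp
      ultimately show ?thesis by (simp only:)
    qed
    have "(\<Sum>n\<in>A. S n) / 2 = (\<Sum>n\<in>A. S n / 2)" by (simp add: sum_divide_distrib)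
    also have "\<dots> \<le> (\<Sum>n\<in>A. Re (2 powr (lam * real n) * (LINT z|\<mu>. \<Phi> n z)))"
      by (rule sum_mono) (rule term_ge)
    also have "\<dots> = Re (\<Sum>n\<in>A. 2 powr (lam * real n) * (LINT z|\<mu>. \<Phi> n z))" by (simp only: Re_sum)
    also have "\<dots> \<le> cmod (\<Sum>n\<in>A. 2 powr (lam * real n) * (LINT z|\<mu>. \<Phi> n z))" by (rule complex_Re_le_cmod)
    also have "\<dots> \<le> B * Cl * P" using A by (intro upper) auto
    finally show ?thesis by simp
  qed
  moreover have "0 \<le> 2 * (B * Cl * P)" using \<open>0 \<le> B\<close> Cl0 P0 by simp
  ultimately show ?thesis unfolding S_def by blast
qed

text \<open>A finite potential bounds all weighted sums over indices beyond some \<open>N\<close>;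
  the finitely many earlier terms are finite, contradicting divergence.\<close>

theorem theorem6:
  fixes \<alpha> lam :: real and U :: "complex set" and x0 :: complex and t :: nat
  assumes "0 < \<alpha>" "\<alpha> < 1" "open U" "x0 \<in> closure U" "0 < lam" "lam < 1"
    and "(\<Sum>n. ennreal (2 powr ((real t + lam + 1) * real (Suc n))) *
            lower_content \<alpha> (annulus x0 (Suc n) - U)) = \<infinity>"
  shows "spike (real t + lam) \<alpha> U x0"
  unfolding spike_def
proof (intro allI impI, rule ccontr)
  fix \<mu> \<gamma>
  assume rep: "representing_measure \<alpha> U x0 \<mu> \<gamma>" and fin: "potential \<mu> (real t + lam) x0 \<noteq> \<infinity>"
  define B where "B = 6272 * (2 / (1 - 2 powr (- \<alpha>)) + 1)"
  have B0: "0 \<le> B" using powr_neg_less_1[OF assms(1)] by (simp add: B_def)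
  \<comment> \<open>All data for one annulus are packed into a tuple, so that a single choice yields
    the four sequences at once.\<close>
  define test where "test n fs \<longleftrightarrow> (case fs of (f, G, a, s) \<Rightarrow>
    0 \<le> s \<and> lower_content \<alpha> (annulus x0 n - U) \<le> ennreal (2 * s) \<and> G \<in> A_alpha \<alpha> U \<and>
    (\<forall>z. z \<noteq> x0 \<longrightarrow> cmod (f z) \<le> B * min 1 ((1 / 2) ^ n / cmod (z - x0))) \<and>
    (\<forall>z. z \<noteq> x0 \<longrightarrow> f z / (z - x0) ^ t = G z + (\<Sum>j<t. a (t - j) / (z - x0) ^ Suc j)) \<and>
    2 ^ (n * Suc t) * s \<le> Re (G x0) \<and> (\<forall>i\<le>t. cmod (a i) \<le> 2 ^ (Suc n * t) * s))"
    for n and fs :: "(complex \<Rightarrow> complex) \<times> (complex \<Rightarrow> complex) \<times> (nat \<Rightarrow> complex) \<times> real"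
  have "\<exists>fs. test n fs" if n: "2 \<le> n" for n
  proof (rule annulus_test_functions[OF assms(1-3) n, of x0 t])
    fix f G a and s :: real
    assume "0 \<le> s" "lower_content \<alpha> (annulus x0 n - U) \<le> ennreal (2 * s)" "G \<in> A_alpha \<alpha> U"
      "\<And>z. z \<noteq> x0 \<Longrightarrow> cmod (f z) \<le>
       6272 * (2 / (1 - 2 powr (- \<alpha>)) + 1) * min 1 ((1 / 2) ^ n / cmod (z - x0))"
      "\<And>z. z \<noteq> x0 \<Longrightarrow> f z / (z - x0) ^ t = G z + (\<Sum>j<t. a (t - j) / (z - x0) ^ Suc j)"
      "2 ^ (n * Suc t) * s \<le> Re (G x0)" "\<And>i. i \<le> t \<Longrightarrow> cmod (a i) \<le> 2 ^ (Suc n * t) * s"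
    then have "test n (f, G, a, s)" unfolding test_def B_def prod.case by blast
    then show "\<exists>fs. test n fs" by blast
  qed
  then have "\<forall>n. \<exists>fs. 2 \<le> n \<longrightarrow> test n fs" by blast
  then obtain fs where fs: "\<And>n. 2 \<le> n \<Longrightarrow> test n (fs n)" by metis
  define f G a s where "f n = fst (fs n)" and "G n = fst (snd (fs n))"
    and "a n = fst (snd (snd (fs n)))" and "s n = snd (snd (snd (fs n)))" for n
  have T: "0 \<le> s n" "lower_content \<alpha> (annulus x0 n - U) \<le> ennreal (2 * s n)" "G n \<in> A_alpha \<alpha> U"
    "\<And>z. z \<noteq> x0 \<Longrightarrow> cmod (f n z) \<le> B * min 1 ((1 / 2) ^ n / cmod (z - x0))"
    "\<And>z. z \<noteq> x0 \<Longrightarrow> f n z / (z - x0) ^ t = G n z + (\<Sum>j<t. a n (t - j) / (z - x0) ^ Suc j)"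
    "2 ^ (n * Suc t) * s n \<le> Re (G n x0)" "\<And>i. i \<le> t \<Longrightarrow> cmod (a n i) \<le> 2 ^ (Suc n * t) * s n"
    if "2 \<le> n" for n
    using fs[OF that] unfolding test_def case_prod_beta f_def G_def a_def s_def by blast+
  have "\<exists>N Q. 0 \<le> Q \<and> (\<forall>A. finite A \<longrightarrow> A \<subseteq> {2..} \<inter> {N..} \<longrightarrow>
     (\<Sum>n\<in>A. 2 powr ((real t + lam + 1) * real n) * s n) \<le> Q)"
    by (rule weighted_masses_bounded[OF rep fin assms(5,6) B0, where f = f and G = G and a = a])
      (simp_all only: atLeast_iff T not_False_eq_True)
  then obtain N Q where Q: "0 \<le> Q"
    "\<And>A. finite A \<Longrightarrow> A \<subseteq> {2..} \<inter> {N..} \<Longrightarrow> (\<Sum>n\<in>A. 2 powr ((real t + lam + 1) * real n) * s n) \<le> Q"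
    by blast
  define w where "w n = ennreal (2 powr ((real t + lam + 1) * real (Suc n)))
    * lower_content \<alpha> (annulus x0 (Suc n) - U)" for n
  \<comment> \<open>The term \<open>w n\<close> belongs to the annulus \<open>Suc n\<close>; the
    shift makes \<open>Suc (n + M)\<close> at least both 2 and \<open>N\<close>.\<close>
  define M where "M = N + 1"
  have w_top: "w n < top" for n
  proof -
    have "annulus x0 (Suc n) - U \<subseteq> ball x0 1"
    proof
      fix z assume "z \<in> annulus x0 (Suc n) - U"
      then have "cmod (z - x0) < 2 powr (- real (Suc n))" by (simp add: annulus_def)
      also have "\<dots> \<le> 1" using powr_neg_less_1[of "real (Suc n)"] by simp
      finally show "z \<in> ball x0 1" by (simp add: dist_norm norm_minus_commute)
    qed
    then obtain h where "lower_content \<alpha> (annulus x0 (Suc n) - U) \<le> 2 * M_h h (annulus x0 (Suc n) - U)"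
      "M_h h (annulus x0 (Suc n) - U) < top"
      by (rule lower_content_le_M_h[of _ x0 \<alpha>]) (use assms in auto)
    then have "lower_content \<alpha> (annulus x0 (Suc n) - U) < top"
      by (auto intro: le_less_trans simp: ennreal_mult_less_top)
    then show ?thesis by (simp add: w_def ennreal_mult_less_top)
  qed
  have tail: "(\<Sum>n<k. w (n + M)) \<le> ennreal (2 * Q)" for k
  proof -
    have "(\<Sum>n<k. w (n + M)) \<le> (\<Sum>n<k. ennreal (2 * (2 powr ((real t + lam + 1) * real (Suc (n + M))) * s (Suc (n + M)))))"
    proof (rule sum_mono)
      fix n
      have "w (n + M) \<le> ennreal (2 powr ((real t + lam + 1) * real (Suc (n + M)))) * ennreal (2 * s (Suc (n + M)))"
        unfolding w_def by (intro mult_left_mono T) (auto simp: M_def)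
      also have "\<dots> = ennreal (2 powr ((real t + lam + 1) * real (Suc (n + M))) * (2 * s (Suc (n + M))))"
        using T(1)[of "Suc (n + M)"] by (intro ennreal_mult[symmetric]) (auto simp: M_def)
      also have "2 powr ((real t + lam + 1) * real (Suc (n + M))) * (2 * s (Suc (n + M)))
          = 2 * (2 powr ((real t + lam + 1) * real (Suc (n + M))) * s (Suc (n + M)))" by simp
      finally show "w (n + M) \<le> ennreal (2 * (2 powr ((real t + lam + 1) * real (Suc (n + M))) * s (Suc (n + M))))" .
    qed
    also have "\<dots> = ennreal (\<Sum>n<k. 2 * (2 powr ((real t + lam + 1) * real (Suc (n + M))) * s (Suc (n + M))))"
      using T(1) by (intro sum_ennreal) (auto simp: M_def)
    also have "(\<Sum>n<k. 2 * (2 powr ((real t + lam + 1) * real (Suc (n + M))) * s (Suc (n + M))))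
        = 2 * (\<Sum>n\<in>(\<lambda>n. Suc (n + M)) ` {..<k}. 2 powr ((real t + lam + 1) * real n) * s n)"
      by (subst sum.reindex) (auto simp: inj_on_def sum_distrib_left)
    also have "ennreal \<dots> \<le> ennreal (2 * Q)"
      by (intro ennreal_leI mult_left_mono Q(2)) (auto simp: M_def)
    finally show ?thesis .
  qed
  \<comment> \<open>The head has to be finite on its own: each of its terms is finite because the
    annuli lie in the unit ball about \<open>x0\<close>.\<close>
  have "(\<Sum>n. w n) = (\<Sum>n. w (n + M)) + (\<Sum>n<M. w n)"
    by (rule suminf_offset) simp
  also have "\<dots> \<le> ennreal (2 * Q) + (\<Sum>n<M. w n)"
    using tail by (intro add_right_mono suminf_le_const) auto
  also have "\<dots> < top"
  proof -
    have "(\<Sum>n<k. w n) < top" for k by (induction k) (use w_top in auto)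
    then show ?thesis by simp
  qed
  finally show False using assms(7) by (simp add: w_def)
qed

end
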